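(* There is an algorithm which, given an acyclic quiver $Q$, an integer $k\in\mathbb N$ and embeddings $m_i\colon Q_i\to Q$ ($i\in\{0,\dots,k-1\}$) of acyclic quivers, decides whether the sentence $\mathrm{Commerge}_{m_0,\dots,m_{k-1}}:=\forall x{:}Q,\ \bigwedge_{i=0}^{k-1}\mathrm{commute}_{Q_i}(\mathrm{restr}_{m_i}(x))\to\mathrm{commute}_Q(x)$ holds in every model of $\Sigma$ satisfying $\mathcal T_{\mathrm{cat}}$ (the acyclic commerge problem for $\mathcal T_{\mathrm{cat}}$ is decidable for tuples of embeddings).
   Context: Quivers. A quiver is a tuple $Q=(V_Q,A_Q,s_Q,t_Q)$ with $V_Q$, $A_Q$ finite subsets of $\mathbb N$ and $s_Q,t_Q\colon A_Q\to V_Q$. A morphism $m\colon Q\to Q'$ is a pair of maps $m_V,m_A$ with $s_{Q'}\circ m_A=m_V\circ s_Q$, $t_{Q'}\circ m_A=m_V\circ t_Q$; an embedding if both are injective. $\mathrm{PQ}_k$ has vertices $\{0,\dots,k\}$, arrows $\{0,\dots,k-1\}$, arrow $i\colon i\to i+1$; nontrivial if $k\ge1$. A path of $Q$ of length $k$ is a morphism $p\colon\mathrm{PQ}_k\to Q$; $\mathcal{BP}_Q$ is the set of pairs of paths with the same start and end vertices. $Q$ is acyclic if all its paths are embeddings; $S$ is the set of acyclic quivers. $\Sigma$ is the many-sorted first-order signature with equality $\approx$, sorts the elements of $S$, a function symbol $\mathrm{restr}_m$ from sort $Q$ to sort $Q'$ for each embedding $m\colon Q'\to Q$ of acyclic quivers,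 and a unary predicate $\mathrm{commute}_Q$ for each $Q\in S$. A model gives sets $\mathcal M_Q$, maps $\mathrm{restr}^{\mathcal M}_m$, subsets $\mathrm{commute}^{\mathcal M}_Q$. Theory $\mathcal T_{\mathrm{cat}}$ (all sorts acyclic, all maps embeddings). Named quivers: $\emptyset$; $D_2$ (vertices $0,1$, no arrow); $C_2$ (vertices $0,1$, arrows $0,1\colon0\to1$, embeddings $a_0,a_1\colon\mathrm{PQ}_1\to C_2$); $T$ (vertices $0,1,2$, arrows $0\colon0\to1$, $1\colon0\to2$, $2\colon1\to2$; $e_{01},e_{12},e_{02}\colon\mathrm{PQ}_1\to T$ onto arrows $0,2,1$); $\sigma,\tau\colon\mathrm{PQ}_0\to\mathrm{PQ}_1$ onto vertex $0$, resp. $1$; $\mathrm{sp}_{k,l},\mathrm{tp}_{k,l}\colon\mathrm{PQ}_k\to\mathrm{PQ}_l$ with vertex maps $i\mapsto i$, resp. $i\mapsto i+l-k$; $\mathrm{st}_P\colon D_2\to\mathrm{PQ}_k$ ($k\ge1$), $0\mapsto0$, $1\mapsto k$. Pushout configuration: embeddings $m_1\colon Q\to Q_1$, $m_2\colon Q\to Q_2$, $m_1'\colon Q_1\to Q'$, $m_2'\colon Q_2\to Q'$ with $m_1'm_1=m_2'm_2$, $Q'$ covered by the images of $m_1',m_2'$, and image of $m_1'm_1$ = intersection of images of $m_1'$, $m_2'$. $\mathrm{Cospan}_{m_1',m_2'}(x_1,x_2,x')$: $\mathrm{restr}_{m_1'}(x')\approx x_1\wedge\mathrm{restr}_{m_2'}(x')\approx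 x_2$. Axioms: EmptyEU (exactly one element of sort $\emptyset$); RestrComp ($\mathrm{restr}_m\circ\mathrm{restr}_{m'}=\mathrm{restr}_{m'\circ m}$); PushoutEU (for each pushout configuration, $\mathrm{restr}_{m_1}(x_1)\approx\mathrm{restr}_{m_2}(x_2)\to\exists!x'\,\mathrm{Cospan}_{m_1',m_2'}(x_1,x_2,x')$); with $\mathrm{Comp}(x,y,z)$ := $\exists w{:}T\,(\mathrm{restr}_{e_{01}}w\approx x\wedge\mathrm{restr}_{e_{12}}w\approx y\wedge\mathrm{restr}_{e_{02}}w\approx z\wedge\mathrm{commute}(w))$, CompE: $\forall x,y{:}\mathrm{PQ}_1\,(\mathrm{restr}_\tau x\approx\mathrm{restr}_\sigma y\to\exists z\,\mathrm{Comp}(x,y,z))$; $\mathrm{EqPath}_{P_1,P_2}(x_1,x_2)$ for nontrivial path-quivers := $\mathrm{restr}_{\mathrm{st}}(x_1)\approx\mathrm{restr}_{\mathrm{st}}(x_2)\wedge\forall x\,(\mathrm{Cospan}_{m_1',m_2'}(x_1,x_2,x)\to\mathrm{commute}(x))$ for a pushout configuration $(\mathrm{st}_{P_1},\mathrm{st}_{P_2},m_1',m_2')$; $\mathrm{Id}(x,y)$ := $\mathrm{restr}_\sigma y\approx x\wedge\forall z,w\,((\mathrm{Comp}(y,z,w)\to\mathrm{EqPath}(z,w))\wedge(\mathrm{Comp}(z,y,w)\to\mathrm{EqPath}(z,w)))$; IdE: $\forall x\exists y\,\mathrm{Id}(x,y)$; $\mathrm{EqPath}_{\mathrm{PQ}_0,\mathrm{PQ}_0}(x,y)$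 := $x\approx y$, $\mathrm{EqPath}_{\mathrm{PQ}_0,P}(x,y)$ := $\exists z(\mathrm{Id}(x,z)\wedge\mathrm{EqPath}_{\mathrm{PQ}_1,P}(z,y))$, $\mathrm{EqPath}_{P,\mathrm{PQ}_0}(x,y)$ := $\mathrm{EqPath}_{\mathrm{PQ}_0,P}(y,x)$; reflexivity, symmetry, transitivity of EqPath; EqPathConcat: $\mathrm{EqPath}(x_1,x_2)\wedge\mathrm{EqPath}(x_1',x_2')\wedge\mathrm{restr}_{\mathrm{tp}_{0,k_1}}x_1\approx\mathrm{restr}_{\mathrm{sp}_{0,k_1'}}x_1'\to\forall x_1'',x_2''\,(\mathrm{Cospan}_{\mathrm{sp}_{k_1,k_1+k_1'},\mathrm{tp}_{k_1',k_1+k_1'}}(x_1,x_1',x_1'')\wedge\mathrm{Cospan}_{\mathrm{sp}_{k_2,k_2+k_2'},\mathrm{tp}_{k_2',k_2+k_2'}}(x_2,x_2',x_2'')\to\mathrm{EqPath}(x_1'',x_2''))$ (sorts $\mathrm{PQ}_{k_1},\mathrm{PQ}_{k_2},\mathrm{PQ}_{k_1'},\mathrm{PQ}_{k_2'},\mathrm{PQ}_{k_i+k_i'}$); ComEq: $\forall x{:}C_2\,(\mathrm{commute}(x)\to\mathrm{restr}_{a_0}x\approx\mathrm{restr}_{a_1}x)$; PathCom$_Q$: $\forall x{:}Q\,(\bigwedge_{(p_1,p_2)\in\mathcal{BP}_Q}\mathrm{EqPath}(\mathrm{restr}_{p_1}x,\mathrm{restr}_{p_2}x)\leftrightarrow\mathrm{commute}(x))$.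 *)

theory Defs
  imports "HOL-Library.FuncSet" "HOL-Library.Nat_Bijection"
begin

section \<open>Quivers\<close>

record quiver =
  verts :: "nat set"
  arrs :: "nat set"
  src :: "nat \<Rightarrow> nat"
  tgt :: "nat \<Rightarrow> nat"

text \<open>Source and target maps, and the components of morphisms below, are extensional
  (\<^const>\<open>undefined\<close> off their domain), so that equality of records is equality of
  quivers and of morphisms with given domain.\<close>

definition is_quiver :: "quiver \<Rightarrow> bool" where
  "is_quiver Q \<longleftrightarrow> finite (verts Q) \<and> finite (arrs Q) \<and>
     src Q \<in> arrs Q \<rightarrow>\<^sub>E verts Q \<and> tgt Q \<in> arrs Q \<rightarrow>\<^sub>E verts Q"

record qmor =
  vmap :: "nat \<Rightarrow> nat"
  amap :: "nat \<Rightarrow> nat"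

definition is_mor :: "qmor \<Rightarrow> quiver \<Rightarrow> quiver \<Rightarrow> bool" where
  "is_mor m Q Q' \<longleftrightarrow>
     vmap m \<in> verts Q \<rightarrow>\<^sub>E verts Q' \<and> amap m \<in> arrs Q \<rightarrow>\<^sub>E arrs Q' \<and>
     (\<forall>a\<in>arrs Q. src Q' (amap m a) = vmap m (src Q a) \<and>
                 tgt Q' (amap m a) = vmap m (tgt Q a))"

definition is_embedding :: "qmor \<Rightarrow> quiver \<Rightarrow> quiver \<Rightarrow> bool" where
  "is_embedding m Q Q' \<longleftrightarrow>
     is_mor m Q Q' \<and> inj_on (vmap m) (verts Q) \<and> inj_on (amap m) (arrs Q)"

definition mor_comp :: "quiver \<Rightarrow> qmor \<Rightarrow> qmor \<Rightarrow> qmor" where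
  "mor_comp Q m' m =
     \<lparr>vmap = compose (verts Q) (vmap m') (vmap m),
      amap = compose (arrs Q) (amap m') (amap m)\<rparr>"

definition PQ :: "nat \<Rightarrow> quiver" where
  "PQ k = \<lparr>verts = {0..k}, arrs = {0..<k},
           src = (\<lambda>i\<in>{0..<k}. i), tgt = (\<lambda>i\<in>{0..<k}. i + 1)\<rparr>"

definition acyclic_quiver :: "quiver \<Rightarrow> bool" where
  "acyclic_quiver Q \<longleftrightarrow>
     is_quiver Q \<and> (\<forall>k p. is_mor p (PQ k) Q \<longrightarrow> is_embedding p (PQ k) Q)"

definition acyclic_embedding :: "qmor \<Rightarrow> quiver \<Rightarrow> quiver \<Rightarrow> bool" where
  "acyclic_embedding m Q Q' \<longleftrightarrow>
     acyclic_quiver Q \<and> acyclic_quiver Q' \<and> is_embedding m Q Q'"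

definition bipaths :: "quiver \<Rightarrow> ((nat \<times> qmor) \<times> (nat \<times> qmor)) set" where
  "bipaths Q = {((k, p), (l, q)) | k p l q.
     is_mor p (PQ k) Q \<and> is_mor q (PQ l) Q \<and>
     vmap p 0 = vmap q 0 \<and> vmap p k = vmap q l}"

definition Q_empty :: quiver where
  "Q_empty = \<lparr>verts = {}, arrs = {}, src = (\<lambda>_. undefined), tgt = (\<lambda>_. undefined)\<rparr>"

definition D2 :: quiver where
  "D2 = \<lparr>verts = {0, 1}, arrs = {}, src = (\<lambda>_. undefined), tgt = (\<lambda>_. undefined)\<rparr>"

definition C2 :: quiver where
  "C2 = \<lparr>verts = {0, 1}, arrs = {0, 1},
         src = (\<lambda>i\<in>{0, 1}. 0), tgt = (\<lambda>i\<in>{0, 1}. 1)\<rparr>"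

definition TQ :: quiver where
  "TQ = \<lparr>verts = {0, 1, 2}, arrs = {0, 1, 2},
         src = (\<lambda>i\<in>{0, 1, 2}. if i = 2 then 1 else 0),
         tgt = (\<lambda>i\<in>{0, 1, 2}. if i = 0 then 1 else 2)\<rparr>"

text \<open>The morphism from \<^term>\<open>PQ 1\<close> onto the arrow \<open>a : u \<rightarrow> v\<close>.\<close>

definition arrow_mor :: "nat \<Rightarrow> nat \<Rightarrow> nat \<Rightarrow> qmor" where
  "arrow_mor a u v =
     \<lparr>vmap = (\<lambda>i\<in>{0..1}. if i = 0 then u else v), amap = (\<lambda>i\<in>{0..<1}. a)\<rparr>"

definition a0 :: qmor where "a0 = arrow_mor 0 0 1"
definition a1 :: qmor where "a1 = arrow_mor 1 0 1"
definition e01 :: qmor where "e01 = arrow_mor 0 0 1"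
definition e12 :: qmor where "e12 = arrow_mor 2 1 2"
definition e02 :: qmor where "e02 = arrow_mor 1 0 2"

definition sp :: "nat \<Rightarrow> nat \<Rightarrow> qmor" where
  "sp k l = \<lparr>vmap = (\<lambda>i\<in>{0..k}. i), amap = (\<lambda>i\<in>{0..<k}. i)\<rparr>"

definition tp :: "nat \<Rightarrow> nat \<Rightarrow> qmor" where
  "tp k l = \<lparr>vmap = (\<lambda>i\<in>{0..k}. i + l - k), amap = (\<lambda>i\<in>{0..<k}. i + l - k)\<rparr>"

definition sigma :: qmor where
  "sigma = \<lparr>vmap = (\<lambda>i\<in>{0..0}. 0), amap = (\<lambda>i\<in>{0..<0}. i)\<rparr>"

definition tau :: qmor where
  "tau = \<lparr>vmap = (\<lambda>i\<in>{0..0}. 1), amap = (\<lambda>i\<in>{0..<0}. i)\<rparr>"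

definition st :: "nat \<Rightarrow> qmor" where
  "st k = \<lparr>vmap = (\<lambda>i\<in>{0, 1}. if i = 0 then 0 else k), amap = (\<lambda>_. undefined)\<rparr>"

definition pushout_config ::
  "quiver \<Rightarrow> quiver \<Rightarrow> quiver \<Rightarrow> quiver \<Rightarrow> qmor \<Rightarrow> qmor \<Rightarrow> qmor \<Rightarrow> qmor \<Rightarrow> bool" where
  "pushout_config Q Q1 Q2 Q' m1 m2 m1' m2' \<longleftrightarrow>
     acyclic_embedding m1 Q Q1 \<and> acyclic_embedding m2 Q Q2 \<and>
     acyclic_embedding m1' Q1 Q' \<and> acyclic_embedding m2' Q2 Q' \<and>
     mor_comp Q m1' m1 = mor_comp Q m2' m2 \<and>
     verts Q' = vmap m1' ` verts Q1 \<union> vmap m2' ` verts Q2 \<and>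
     arrs Q' = amap m1' ` arrs Q1 \<union> amap m2' ` arrs Q2 \<and>
     vmap (mor_comp Q m1' m1) ` verts Q = vmap m1' ` verts Q1 \<inter> vmap m2' ` verts Q2 \<and>
     amap (mor_comp Q m1' m1) ` arrs Q = amap m1' ` arrs Q1 \<inter> amap m2' ` arrs Q2"

text \<open>A fixed, otherwise arbitrary, pushout configuration gluing \<^term>\<open>PQ k\<close> and \<^term>\<open>PQ l\<close>
  along their end points (\<open>k, l \<ge> 1\<close>).\<close>

definition parallel_pushout :: "nat \<Rightarrow> nat \<Rightarrow> quiver \<times> qmor \<times> qmor" where
  "parallel_pushout k l =
     (SOME (Q', m1', m2'). pushout_config D2 (PQ k) (PQ l) Q' (st k) (st l) m1' m2')"


section \<open>Structures for the signature and the theory of categories\<close>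

text \<open>The sorts are the acyclic quivers. The function symbol of an embedding \<open>m : Q' \<rightarrow> Q\<close>,
  going from sort \<open>Q\<close> to sort \<open>Q'\<close>, is interpreted by \<open>restr M Q' Q m\<close>. Values of the fields
  at other indices are irrelevant. As the sorts are separate, any family of carrier sets can be
  realised inside one sufficiently large type \<open>'a\<close>. Truth in every model is thus truth in the
  models over \<open>'a\<close>, for every type \<open>'a\<close>. Since a formula cannot quantify over types, a decision
  procedure is pinned down independently of \<open>'a\<close> by its negative answers: those must be justified
  by a model over \<^typ>\<open>nat\<close>, which is no restriction as the signature is countable
  (Loewenheim-Skolem).\<close>

record 'a interp =
  carrier :: "quiver \<Rightarrow> 'a set"
  restr :: "quiver \<Rightarrow> quiver \<Rightarrow> qmor \<Rightarrow> 'a \<Rightarrow> 'a"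
  commute :: "quiver \<Rightarrow> 'a set"

definition is_model :: "'a interp \<Rightarrow> bool" where
  "is_model M \<longleftrightarrow>
     (\<forall>Q' Q m. acyclic_embedding m Q' Q \<longrightarrow> restr M Q' Q m \<in> carrier M Q \<rightarrow> carrier M Q') \<and>
     (\<forall>Q. acyclic_quiver Q \<longrightarrow> commute M Q \<subseteq> carrier M Q)"

definition Cospan ::
  "'a interp \<Rightarrow> quiver \<Rightarrow> quiver \<Rightarrow> quiver \<Rightarrow> qmor \<Rightarrow> qmor \<Rightarrow> 'a \<Rightarrow> 'a \<Rightarrow> 'a \<Rightarrow> bool" where
  "Cospan M Q1 Q2 Q' m1' m2' x1 x2 x' \<longleftrightarrow>
     restr M Q1 Q' m1' x' = x1 \<and> restr M Q2 Q' m2' x' = x2"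

definition Comp :: "'a interp \<Rightarrow> 'a \<Rightarrow> 'a \<Rightarrow> 'a \<Rightarrow> bool" where
  "Comp M x y z \<longleftrightarrow> (\<exists>w\<in>carrier M TQ.
     restr M (PQ 1) TQ e01 w = x \<and> restr M (PQ 1) TQ e12 w = y \<and>
     restr M (PQ 1) TQ e02 w = z \<and> w \<in> commute M TQ)"

definition EqPath_nontriv :: "'a interp \<Rightarrow> nat \<Rightarrow> nat \<Rightarrow> 'a \<Rightarrow> 'a \<Rightarrow> bool" where
  "EqPath_nontriv M k l x1 x2 \<longleftrightarrow>
     restr M D2 (PQ k) (st k) x1 = restr M D2 (PQ l) (st l) x2 \<and>
     (case parallel_pushout k l of (Q', m1', m2') \<Rightarrow>
        \<forall>x\<in>carrier M Q'. Cospan M (PQ k) (PQ l) Q' m1' m2' x1 x2 x \<longrightarrow> x \<in> commute M Q')"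

definition Ident :: "'a interp \<Rightarrow> 'a \<Rightarrow> 'a \<Rightarrow> bool" where
  "Ident M x y \<longleftrightarrow>
     restr M (PQ 0) (PQ 1) sigma y = x \<and>
     (\<forall>z\<in>carrier M (PQ 1). \<forall>w\<in>carrier M (PQ 1).
        (Comp M y z w \<longrightarrow> EqPath_nontriv M 1 1 z w) \<and>
        (Comp M z y w \<longrightarrow> EqPath_nontriv M 1 1 z w))"

text \<open>\<open>EqPath M k l\<close> relates the sorts \<^term>\<open>PQ k\<close> and \<^term>\<open>PQ l\<close>.\<close>

fun EqPath :: "'a interp \<Rightarrow> nat \<Rightarrow> nat \<Rightarrow> 'a \<Rightarrow> 'a \<Rightarrow> bool" where
  "EqPath M 0 0 x y \<longleftrightarrow> x = y"
| "EqPath M 0 (Suc l) x y \<longleftrightarrow>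
     (\<exists>z\<in>carrier M (PQ 1). Ident M x z \<and> EqPath_nontriv M 1 (Suc l) z y)"
| "EqPath M (Suc k) 0 x y \<longleftrightarrow> EqPath M 0 (Suc k) y x"
| "EqPath M (Suc k) (Suc l) x y \<longleftrightarrow> EqPath_nontriv M (Suc k) (Suc l) x y"

definition EmptyEU :: "'a interp \<Rightarrow> bool" where
  "EmptyEU M \<longleftrightarrow> (\<exists>!x. x \<in> carrier M Q_empty)"

definition RestrComp :: "'a interp \<Rightarrow> bool" where
  "RestrComp M \<longleftrightarrow> (\<forall>Q Q' Q'' m m'.
     acyclic_embedding m Q Q' \<and> acyclic_embedding m' Q' Q'' \<longrightarrow>
     (\<forall>x\<in>carrier M Q''. restr M Q Q' m (restr M Q' Q'' m' x) = restr M Q Q'' (mor_comp Q m' m) x))"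

definition PushoutEU :: "'a interp \<Rightarrow> bool" where
  "PushoutEU M \<longleftrightarrow> (\<forall>Q Q1 Q2 Q' m1 m2 m1' m2'.
     pushout_config Q Q1 Q2 Q' m1 m2 m1' m2' \<longrightarrow>
     (\<forall>x1\<in>carrier M Q1. \<forall>x2\<in>carrier M Q2.
        restr M Q Q1 m1 x1 = restr M Q Q2 m2 x2 \<longrightarrow>
        (\<exists>!x'. x' \<in> carrier M Q' \<and> Cospan M Q1 Q2 Q' m1' m2' x1 x2 x')))"

definition CompE :: "'a interp \<Rightarrow> bool" where
  "CompE M \<longleftrightarrow> (\<forall>x\<in>carrier M (PQ 1). \<forall>y\<in>carrier M (PQ 1).
     restr M (PQ 0) (PQ 1) tau x = restr M (PQ 0) (PQ 1) sigma y \<longrightarrow>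
     (\<exists>z\<in>carrier M (PQ 1). Comp M x y z))"

definition IdE :: "'a interp \<Rightarrow> bool" where
  "IdE M \<longleftrightarrow> (\<forall>x\<in>carrier M (PQ 0). \<exists>y\<in>carrier M (PQ 1). Ident M x y)"

definition EqPathRefl :: "'a interp \<Rightarrow> bool" where
  "EqPathRefl M \<longleftrightarrow> (\<forall>k. \<forall>x\<in>carrier M (PQ k). EqPath M k k x x)"

definition EqPathSym :: "'a interp \<Rightarrow> bool" where
  "EqPathSym M \<longleftrightarrow> (\<forall>k l. \<forall>x\<in>carrier M (PQ k). \<forall>y\<in>carrier M (PQ l).
     EqPath M k l x y \<longrightarrow> EqPath M l k y x)"

definition EqPathTrans :: "'a interp \<Rightarrow> bool" where
  "EqPathTrans M \<longleftrightarrow> (\<forall>k l n.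
     \<forall>x\<in>carrier M (PQ k). \<forall>y\<in>carrier M (PQ l). \<forall>z\<in>carrier M (PQ n).
     EqPath M k l x y \<and> EqPath M l n y z \<longrightarrow> EqPath M k n x z)"

definition EqPathConcat :: "'a interp \<Rightarrow> bool" where
  "EqPathConcat M \<longleftrightarrow> (\<forall>k1 k2 k1' k2'.
     \<forall>x1\<in>carrier M (PQ k1). \<forall>x2\<in>carrier M (PQ k2).
     \<forall>x1'\<in>carrier M (PQ k1'). \<forall>x2'\<in>carrier M (PQ k2').
     EqPath M k1 k2 x1 x2 \<and> EqPath M k1' k2' x1' x2' \<and>
     restr M (PQ 0) (PQ k1) (tp 0 k1) x1 = restr M (PQ 0) (PQ k1') (sp 0 k1') x1' \<longrightarrow>
     (\<forall>x1''\<in>carrier M (PQ (k1 + k1')). \<forall>x2''\<in>carrier M (PQ (k2 + k2')).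
        Cospan M (PQ k1) (PQ k1') (PQ (k1 + k1'))
          (sp k1 (k1 + k1')) (tp k1' (k1 + k1')) x1 x1' x1'' \<and>
        Cospan M (PQ k2) (PQ k2') (PQ (k2 + k2'))
          (sp k2 (k2 + k2')) (tp k2' (k2 + k2')) x2 x2' x2'' \<longrightarrow>
        EqPath M (k1 + k1') (k2 + k2') x1'' x2''))"

definition ComEq :: "'a interp \<Rightarrow> bool" where
  "ComEq M \<longleftrightarrow> (\<forall>x\<in>carrier M C2.
     x \<in> commute M C2 \<longrightarrow> restr M (PQ 1) C2 a0 x = restr M (PQ 1) C2 a1 x)"

definition PathCom :: "'a interp \<Rightarrow> bool" where
  "PathCom M \<longleftrightarrow> (\<forall>Q. acyclic_quiver Q \<longrightarrow> (\<forall>x\<in>carrier M Q.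
     (\<forall>((k, p), (l, q))\<in>bipaths Q. EqPath M k l (restr M (PQ k) Q p x) (restr M (PQ l) Q q x))
     \<longleftrightarrow> x \<in> commute M Q))"

definition is_Tcat_model :: "'a interp \<Rightarrow> bool" where
  "is_Tcat_model M \<longleftrightarrow> is_model M \<and>
     EmptyEU M \<and> RestrComp M \<and> PushoutEU M \<and> CompE M \<and> IdE M \<and>
     EqPathRefl M \<and> EqPathSym M \<and> EqPathTrans M \<and> EqPathConcat M \<and> ComEq M \<and> PathCom M"


section \<open>Commerge instances\<close>

text \<open>A tuple \<open>m\<^sub>0, \<dots>, m\<^bsub>k-1\<^esub>\<close> of embeddings into \<open>Q\<close> is a list of pairs \<open>(Q\<^sub>i, m\<^sub>i)\<close>.\<close>

definition commerge_instance :: "quiver \<Rightarrow> (quiver \<times> qmor) list \<Rightarrow> bool" where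
  "commerge_instance Q ms \<longleftrightarrow> acyclic_quiver Q \<and>
     (\<forall>i<length ms. acyclic_quiver (fst (ms ! i)) \<and> is_embedding (snd (ms ! i)) (fst (ms ! i)) Q)"

definition Commerge :: "'a interp \<Rightarrow> quiver \<Rightarrow> (quiver \<times> qmor) list \<Rightarrow> bool" where
  "Commerge M Q ms \<longleftrightarrow> (\<forall>x\<in>carrier M Q.
     (\<forall>i<length ms. restr M (fst (ms ! i)) Q (snd (ms ! i)) x \<in> commute M (fst (ms ! i)))
     \<longrightarrow> x \<in> commute M Q)"


section \<open>Algorithms\<close>

text \<open>Kleene's partial recursive functions, with big-step evaluation.\<close>

datatype recf = Zero | Succ | Proj nat | Cn recf "recf list" | Pr recf recf | Mn recf

inductive rec_eval :: "recf \<Rightarrow> nat list \<Rightarrow> nat \<Rightarrow> bool" where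
  zero: "rec_eval Zero xs 0"
| succ: "rec_eval Succ [x] (Suc x)"
| proj: "i < length xs \<Longrightarrow> rec_eval (Proj i) xs (xs ! i)"
| comp: "list_all2 (\<lambda>g y. rec_eval g xs y) gs ys \<Longrightarrow> rec_eval f ys z \<Longrightarrow> rec_eval (Cn f gs) xs z"
| prec_0: "rec_eval f xs y \<Longrightarrow> rec_eval (Pr f g) (0 # xs) y"
| prec_Suc: "rec_eval (Pr f g) (n # xs) y \<Longrightarrow> rec_eval g (n # y # xs) z \<Longrightarrow>
    rec_eval (Pr f g) (Suc n # xs) z"
| minim: "rec_eval f (n # xs) 0 \<Longrightarrow> (\<forall>i<n. \<exists>y. rec_eval f (i # xs) (Suc y)) \<Longrightarrow>
    rec_eval (Mn f) xs n"

inductive_cases rec_eval_ZeroE: "rec_eval Zero xs z"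
inductive_cases rec_eval_SuccE: "rec_eval Succ xs z"
inductive_cases rec_eval_ProjE: "rec_eval (Proj i) xs z"
inductive_cases rec_eval_CnE: "rec_eval (Cn f gs) xs z"
inductive_cases rec_eval_Pr0E: "rec_eval (Pr f g) (0 # xs) z"
inductive_cases rec_eval_PrSucE: "rec_eval (Pr f g) (Suc n # xs) z"
inductive_cases rec_eval_MnE: "rec_eval (Mn f) xs z"

lemma rec_eval_functional: "rec_eval e xs y \<Longrightarrow> rec_eval e xs z \<Longrightarrow> y = z"
proof (induction arbitrary: z rule: rec_eval.induct)
  case (zero xs)
  then show ?case by (blast elim: rec_eval_ZeroE)
next
  case (succ x)
  then show ?case by (rule rec_eval_SuccE) simp
next
  case (proj i xs)
  from proj.prems show ?case by (rule rec_eval_ProjE) simp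
next
  case (comp xs gs ys f w)
  from comp.prems obtain ys' where ys': "list_all2 (\<lambda>g y. rec_eval g xs y) gs ys'" "rec_eval f ys' z"
    by (rule rec_eval_CnE)
  have "ys = ys'"
  proof (rule nth_equalityI)
    show "length ys = length ys'"
      using list_all2_lengthD[OF comp.IH(1)] list_all2_lengthD[OF ys'(1)] by simp
    fix i assume "i < length ys"
    then show "ys ! i = ys' ! i"
      using comp.IH(1) ys'(1) by (simp add: list_all2_conv_all_nth)
  qed
  then show ?case using comp.IH(2) ys'(2) by blast
next
  case (prec_0 f xs y g)
  from prec_0.prems show ?case by (rule rec_eval_Pr0E) (rule prec_0.IH)
next
  case (prec_Suc f g n xs y w)
  from prec_Suc.prems show ?case
    by (rule rec_eval_PrSucE) (use prec_Suc.IH in blast)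
next
  case (minim f n xs)
  from minim.prems have z: "rec_eval f (z # xs) 0" "\<forall>i<z. \<exists>y. rec_eval f (i # xs) (Suc y)"
    by (rule rec_eval_MnE; simp)+
  show ?case
  proof (rule linorder_cases[of n z])
    assume "n < z"
    with z(2) minim.IH(1) show ?thesis by blast
  next
    assume "z < n"
    with z(1) minim.IH(2) show ?thesis by blast
  qed
qed

text \<open>Codes of the inputs. Finite sets are coded in binary by \<^const>\<open>set_encode\<close>, functions on
  finite sets by their graphs.\<close>

definition fun_code :: "nat set \<Rightarrow> (nat \<Rightarrow> nat) \<Rightarrow> nat" where
  "fun_code A f = set_encode ((\<lambda>a. prod_encode (a, f a)) ` A)"

definition quiver_code :: "quiver \<Rightarrow> nat" where
  "quiver_code Q = list_encode
     [set_encode (verts Q), set_encode (arrs Q), fun_code (arrs Q) (src Q), fun_code (arrs Q) (tgt Q)]"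

definition mor_code :: "quiver \<Rightarrow> qmor \<Rightarrow> nat" where
  "mor_code Q m = prod_encode (fun_code (verts Q) (vmap m), fun_code (arrs Q) (amap m))"

definition instance_code :: "quiver \<Rightarrow> (quiver \<times> qmor) list \<Rightarrow> nat" where
  "instance_code Q ms = prod_encode (quiver_code Q,
     list_encode (map (\<lambda>(Q', m). prod_encode (quiver_code Q', mor_code Q' m)) ms))"

lemma fun_code_inj:
  assumes "finite A" "finite B" "fun_code A f = fun_code B g"
  shows "A = B \<and> (\<forall>a\<in>A. f a = g a)"
proof -
  have "prod_encode ` (\<lambda>a. (a, f a)) ` A = prod_encode ` (\<lambda>a. (a, g a)) ` B"
    using assms by (simp add: fun_code_def set_encode_eq image_image)
  then have *: "(\<lambda>a. (a, f a)) ` A = (\<lambda>a. (a, g a)) ` B"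
    by (simp only: inj_image_eq_iff[OF inj_prod_encode])
  have "fst ` (\<lambda>a. (a, f a)) ` A = fst ` (\<lambda>a. (a, g a)) ` B"
    using * by (rule arg_cong)
  then have "A = B" by (simp add: image_image)
  moreover have "f a = g a" if "a \<in> A" for a
  proof -
    have "(a, f a) \<in> (\<lambda>a. (a, g a)) ` B" using that * by blast
    then show ?thesis by auto
  qed
  ultimately show ?thesis by blast
qed

lemma extensional_eqI: "f \<in> A \<rightarrow>\<^sub>E B \<Longrightarrow> g \<in> A \<rightarrow>\<^sub>E B' \<Longrightarrow> \<forall>a\<in>A. f a = g a \<Longrightarrow> f = g"
  by (rule extensionalityI[of f A g]) (auto simp: PiE_iff)

lemma quiver_code_inj:
  assumes "is_quiver Q" "is_quiver Q'" "quiver_code Q = quiver_code Q'"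
  shows "Q = Q'"
proof -
  have f: "finite (verts Q)" "finite (arrs Q)" "finite (verts Q')" "finite (arrs Q')"
    using assms by (auto simp: is_quiver_def)
  then have 1: "verts Q = verts Q'" "arrs Q = arrs Q'"
    and 2: "\<forall>a\<in>arrs Q. src Q a = src Q' a" "\<forall>a\<in>arrs Q. tgt Q a = tgt Q' a"
    using assms(3) fun_code_inj[of "arrs Q" "arrs Q'"]
    by (auto simp: quiver_code_def list_encode_eq set_encode_eq simp del: list_encode.simps)
  have "src Q = src Q'" "tgt Q = tgt Q'"
    using assms(1,2) 1 2 unfolding is_quiver_def
    by (auto intro: extensional_eqI)
  with 1 show ?thesis by (simp add: quiver.equality)
qed

lemma mor_code_inj:
  assumes "is_quiver Q" "is_mor m Q Q1" "is_mor m' Q Q1" "mor_code Q m = mor_code Q m'"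
  shows "m = m'"
proof -
  have "finite (verts Q)" "finite (arrs Q)" using assms by (auto simp: is_quiver_def)
  then have "\<forall>v\<in>verts Q. vmap m v = vmap m' v" "\<forall>a\<in>arrs Q. amap m a = amap m' a"
    using assms(4) fun_code_inj by (auto simp: mor_code_def prod_encode_eq)
  then have "vmap m = vmap m'" "amap m = amap m'"
    using assms(2,3) unfolding is_mor_def by (auto intro: extensional_eqI)
  then show ?thesis by (simp add: qmor.equality)
qed

lemma instance_code_inj:
  assumes "commerge_instance Q ms" "commerge_instance Q' ms'"
    and "instance_code Q ms = instance_code Q' ms'"
  shows "Q = Q' \<and> ms = ms'"
proof -
  let ?c = "\<lambda>(Q', m). prod_encode (quiver_code Q', mor_code Q' m)"
  have qc: "quiver_code Q = quiver_code Q'" and c: "map ?c ms = map ?c ms'"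
    using assms(3) unfolding instance_code_def prod_encode_eq prod.inject list_encode_eq by simp_all
  have Q: "Q = Q'"
    using assms(1,2) qc by (simp add: commerge_instance_def acyclic_quiver_def quiver_code_inj)
  from c have l: "length ms = length ms'" by (rule map_eq_imp_length_eq)
  have "ms ! i = ms' ! i" if i: "i < length ms" for i
  proof -
    have "?c (ms ! i) = ?c (ms' ! i)" using arg_cong[OF c, of "\<lambda>xs. xs ! i"] l i by simp
    then have "quiver_code (fst (ms ! i)) = quiver_code (fst (ms' ! i))"
      and *: "mor_code (fst (ms ! i)) (snd (ms ! i)) = mor_code (fst (ms' ! i)) (snd (ms' ! i))"
      by (simp_all add: case_prod_beta)
    moreover have q: "is_quiver (fst (ms ! i))" "is_quiver (fst (ms' ! i))"
      and m: "is_mor (snd (ms ! i)) (fst (ms ! i)) Q" "is_mor (snd (ms' ! i)) (fst (ms' ! i)) Q"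
      using assms(1,2) i l Q
      by (auto simp: commerge_instance_def acyclic_quiver_def is_embedding_def)
    ultimately have fst: "fst (ms ! i) = fst (ms' ! i)" using quiver_code_inj by blast
    have "snd (ms ! i) = snd (ms' ! i)"
      using mor_code_inj[OF q(1) m(1)] m(2) * unfolding fst by simp
    with fst show ?thesis by (rule prod_eqI)
  qed
  with Q l show ?thesis by (auto intro: nth_equalityI)
qed

end

theory Submission imports Defs "HOL-Library.Countable" begin

text \<open>A commerge sentence holds in all models iff the path congruence on \<open>Q\<close> generated by the pairs of
  parallel paths inside the images of the \<open>m\<^sub>i\<close> identifies all parallel paths of \<open>Q\<close>. If it does,
  then the \<^const>\<open>EqPath\<close> axioms propagate commutativity from the \<open>Q\<^sub>i\<close> to \<open>Q\<close>. If it does not, the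
  classes of the congruence, with a unit and a zero for non-composable classes added, form a
  countable monoid. Seen as a category with one object it is a model, in which the
  tautological labelling of \<open>Q\<close> refutes the sentence.

  As \<open>Q\<close> is acyclic, a path is determined by its start and its finite set of arrows, so all
  paths are coded by numbers below the code of the instance. The congruence is the intersection of
  the relations on these numbers closed under finitely many rules, and bounded quantification
  over codes of relations decides membership in it.\<close>


section \<open>Recursive functions\<close>

text \<open>With a single object, a diagram is an arbitrary labelling of arrows: diagrams glue along
  every pushout, and the end point conditions in \<open>EqPath\<close> hold automatically. The price
  is that labels which do not compose still need a product, and that the empty product is the unit
  of the monoid, not the class of a trivial path. This does no harm, since in an acyclic quiver
  every path parallel to a trivial path is trivial. The same distinction shapes the soundness proof,
  where a trivial path at a vertex outside the image of an embedding cannot be lifted.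
  \<open>EqPath\<close> refers to an arbitrarily chosen pushout, so the parallel paths of that
  pushout have to be found from the pushout conditions alone. Up to order, its two branches are the
  only distinct ones. On the side of computation the obstacle is to prove an algorithm recursive at
  the level of \<open>recf\<close>. Taking the congruence as an intersection of closed relations,
  instead of computing it by iteration, reduces this to closure of decidable predicates under
  bounded quantification.\<close>

definition recursive :: "(nat \<Rightarrow> nat) \<Rightarrow> bool" where
  "recursive f \<longleftrightarrow> (\<exists>e. \<forall>x. rec_eval e [x] (f x))"

definition decidable :: "(nat \<Rightarrow> bool) \<Rightarrow> bool" where
  "decidable P \<longleftrightarrow> recursive (\<lambda>x. of_bool (P x))"

text \<open>The closure rules take subexpressions that depend on the common argument, so that
  backward application follows the syntax of an expression.\<close>

named_theorems rec_intros

lemma rec_eval_proj: "i < length xs \<Longrightarrow> y = xs ! i \<Longrightarrow> rec_eval (Proj i) xs y"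
  by (simp add: rec_eval.proj)

lemma rec_eval_Cn1: "rec_eval g xs y \<Longrightarrow> rec_eval f [y] z \<Longrightarrow> rec_eval (Cn f [g]) xs z"
  by (rule rec_eval.comp[where ys = "[y]"]) simp_all

lemma rec_eval_Cn2:
  "rec_eval g xs y \<Longrightarrow> rec_eval h xs z \<Longrightarrow> rec_eval f [y, z] w \<Longrightarrow> rec_eval (Cn f [g, h]) xs w"
  by (rule rec_eval.comp[where ys = "[y, z]"]) simp_all

lemma rec_eval_Suc: "rec_eval g xs y \<Longrightarrow> rec_eval (Cn Succ [g]) xs (Suc y)"
  by (rule rec_eval_Cn1[OF _ rec_eval.succ])

definition rec_add :: recf where
  "rec_add = Pr (Proj 0) (Cn Succ [Proj 1])"

lemma rec_eval_add: "rec_eval rec_add [x, y] (x + y)"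
  unfolding rec_add_def
  by (induction x) (auto intro!: rec_eval.prec_0 rec_eval_proj rec_eval.prec_Suc rec_eval_Suc)

definition rec_pred :: recf where
  "rec_pred = Pr Zero (Proj 0)"

lemma rec_eval_pred: "rec_eval rec_pred [x] (x - 1)"
  unfolding rec_pred_def
  by (induction x) (auto intro!: rec_eval.prec_0 rec_eval.zero rec_eval_proj intro: rec_eval.prec_Suc)

definition rec_diff :: recf where
  "rec_diff = Cn (Pr (Proj 0) (Cn rec_pred [Proj 1])) [Proj 1, Proj 0]"

lemma rec_eval_diff: "rec_eval rec_diff [x, y] (x - y)"
proof -
  have "rec_eval (Pr (Proj 0) (Cn rec_pred [Proj 1])) [y, x] (x - y)"
  proof (induction y)
    case (Suc y)
    have "rec_eval (Cn rec_pred [Proj 1]) [y, x - y, x] (x - y - 1)"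
      by (rule rec_eval_Cn1[OF _ rec_eval_pred]) (simp add: rec_eval_proj)
    with Suc show ?case by (auto intro: rec_eval.prec_Suc)
  qed (auto intro!: rec_eval.prec_0 rec_eval_proj)
  then show ?thesis
    unfolding rec_diff_def by (auto intro!: rec_eval_Cn2 rec_eval_proj)
qed

definition rec_triangle :: recf where
  "rec_triangle = Pr Zero (Cn Succ [Cn rec_add [Proj 1, Proj 0]])"

lemma rec_eval_triangle: "rec_eval rec_triangle [n] (triangle n)"
proof (induction n)
  case (Suc n)
  have "rec_eval (Cn Succ [Cn rec_add [Proj 1, Proj 0]]) [n, triangle n] (Suc (triangle n + n))"
    by (intro rec_eval_Suc rec_eval_Cn2[OF _ _ rec_eval_add]) (simp_all add: rec_eval_proj)
  with Suc show ?case unfolding rec_triangle_def by (auto intro: rec_eval.prec_Suc)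
qed (auto simp: rec_triangle_def intro!: rec_eval.prec_0 rec_eval.zero)

definition rec_pair :: recf where
  "rec_pair = Cn rec_add [Cn rec_triangle [rec_add], Proj 0]"

lemma rec_eval_pair: "rec_eval rec_pair [x, y] (prod_encode (x, y))"
  unfolding rec_pair_def prod_encode_def
  by (auto intro!: rec_eval_Cn2[OF _ _ rec_eval_add] rec_eval_Cn1[OF _ rec_eval_triangle]
      rec_eval_add rec_eval_proj)

section \<open>Inverting the pairing function\<close>

definition pfst :: "nat \<Rightarrow> nat" where "pfst z = fst (prod_decode z)"
definition psnd :: "nat \<Rightarrow> nat" where "psnd z = snd (prod_decode z)"

lemma pfst_pair [simp]: "pfst (prod_encode (x, y)) = x"
  and psnd_pair [simp]: "psnd (prod_encode (x, y)) = y"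
  by (simp_all add: pfst_def psnd_def)

lemma triangle_mono: "m \<le> n \<Longrightarrow> triangle m \<le> triangle n"
  by (rule lift_Suc_mono_le[of triangle]) simp_all

text \<open>The diagonal \<open>pfst z + psnd z\<close> on which the pair coded by \<open>z\<close> lies is the least \<open>k\<close>
  with \<open>z < triangle (Suc k)\<close>.\<close>

definition rec_diag :: recf where
  "rec_diag = Mn (Cn rec_diff [Cn Succ [Proj 1], Cn rec_triangle [Cn Succ [Proj 0]]])"

lemma rec_eval_diag: "rec_eval rec_diag [z] (pfst z + psnd z)"
proof -
  obtain m n where z: "z = prod_encode (m, n)" by (metis prod.collapse prod_decode_inverse)
  let ?f = "Cn rec_diff [Cn Succ [Proj 1], Cn rec_triangle [Cn Succ [Proj 0]]]"
  have f: "rec_eval ?f [k, z] (Suc z - triangle (Suc k))" for k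
    by (intro rec_eval_Cn2[OF _ _ rec_eval_diff] rec_eval_Cn1[OF _ rec_eval_triangle] rec_eval_Suc)
      (simp_all add: rec_eval_proj)
  have "rec_eval rec_diag [z] (m + n)"
    unfolding rec_diag_def
  proof (rule rec_eval.minim)
    have "Suc z - triangle (Suc (m + n)) = 0" by (simp add: z prod_encode_def)
    then show "rec_eval ?f [m + n, z] 0" using f[of "m + n"] by simp
    show "\<forall>i<m + n. \<exists>y. rec_eval ?f [i, z] (Suc y)"
    proof (intro allI impI)
      fix i assume "i < m + n"
      then have "triangle (Suc i) \<le> z"
        using triangle_mono[of "Suc i" "m + n"] by (simp add: z prod_encode_def)
      then have "Suc z - triangle (Suc i) = Suc (z - triangle (Suc i))" by simp
      then show "\<exists>y. rec_eval ?f [i, z] (Suc y)" using f[of i] by metis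
    qed
  qed
  then show ?thesis by (simp add: z)
qed

text \<open>Diagonal \<open>k\<close> starts at the code \<open>triangle k\<close>, and the offset
  of a pair on its diagonal is its first component.\<close>

definition rec_fst :: recf where
  "rec_fst = Cn rec_diff [Proj 0, Cn rec_triangle [rec_diag]]"

lemma rec_eval_fst: "rec_eval rec_fst [z] (pfst z)"
proof -
  obtain m n where z: "z = prod_encode (m, n)" by (metis prod.collapse prod_decode_inverse)
  have "rec_eval rec_fst [z] (z - triangle (pfst z + psnd z))"
    unfolding rec_fst_def
    by (auto intro!: rec_eval_Cn2[OF _ _ rec_eval_diff] rec_eval_Cn1[OF _ rec_eval_triangle]
        rec_eval_proj rec_eval_diag)
  then show ?thesis by (simp add: z) (simp add: prod_encode_def)
qed

definition rec_snd :: recf where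
  "rec_snd = Cn rec_diff [rec_diag, rec_fst]"

lemma rec_eval_snd: "rec_eval rec_snd [z] (psnd z)"
  using rec_eval_Cn2[OF rec_eval_diag rec_eval_fst rec_eval_diff, of z] by (simp add: rec_snd_def)

section \<open>Closure properties of recursive functions\<close>

lemma recursive_id [rec_intros]: "recursive (\<lambda>x. x)"
  unfolding recursive_def by (rule exI[of _ "Proj 0"]) (simp add: rec_eval_proj)

lemma recursive_comp:
  assumes "recursive f" "recursive g"
  shows "recursive (\<lambda>x. f (g x))"
  using assms unfolding recursive_def by (meson rec_eval_Cn1)

lemma recursive_const [rec_intros]: "recursive (\<lambda>_. c)"
proof (induction c)
  case 0
  show ?case unfolding recursive_def by (rule exI[of _ Zero]) (simp add: rec_eval.zero)
next
  case (Suc c)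
  then show ?case unfolding recursive_def by (meson rec_eval_Suc)
qed

lemma recursive_Suc [rec_intros]: "recursive f \<Longrightarrow> recursive (\<lambda>x. Suc (f x))"
  unfolding recursive_def by (meson rec_eval_Suc)

lemma recursive_pair [rec_intros]:
  "recursive f \<Longrightarrow> recursive g \<Longrightarrow> recursive (\<lambda>x. prod_encode (f x, g x))"
  unfolding recursive_def by (meson rec_eval_Cn2 rec_eval_pair)

lemma recursive_pfst [rec_intros]: "recursive f \<Longrightarrow> recursive (\<lambda>x. pfst (f x))"
  unfolding recursive_def by (meson rec_eval_Cn1 rec_eval_fst)

lemma recursive_psnd [rec_intros]: "recursive f \<Longrightarrow> recursive (\<lambda>x. psnd (f x))"
  unfolding recursive_def by (meson rec_eval_Cn1 rec_eval_snd)

lemma recursive_add [rec_intros]: "recursive f \<Longrightarrow> recursive g \<Longrightarrow> recursive (\<lambda>x. f x + g x)"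
  unfolding recursive_def by (meson rec_eval_Cn2 rec_eval_add)

lemma recursive_diff [rec_intros]: "recursive f \<Longrightarrow> recursive g \<Longrightarrow> recursive (\<lambda>x. f x - g x)"
  unfolding recursive_def by (meson rec_eval_Cn2 rec_eval_diff)

text \<open>A function of several arguments is treated as one of the code of the argument tuple. The step
  function of a primitive recursion thus sees parameter, counter and previous value as
  \<open>pfst z\<close>, \<open>pfst (psnd z)\<close> and \<open>psnd (psnd z)\<close>.\<close>

lemma recursive_rec_nat [rec_intros]:
  assumes "recursive g" "recursive n" "recursive (\<lambda>z. h (pfst z) (pfst (psnd z)) (psnd (psnd z)))"
  shows "recursive (\<lambda>x. rec_nat (g x) (h x) (n x))"
proof -
  obtain eg en eh where eg: "\<And>x. rec_eval eg [x] (g x)" and en: "\<And>x. rec_eval en [x] (n x)"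
    and eh: "\<And>z. rec_eval eh [z] (h (pfst z) (pfst (psnd z)) (psnd (psnd z)))"
    using assms unfolding recursive_def by metis
  let ?s = "Cn eh [Cn rec_pair [Proj 2, Cn rec_pair [Proj 0, Proj 1]]]"
  have s: "rec_eval ?s [k, r, x] (h x k r)" for k r x
    using eh[of "prod_encode (x, prod_encode (k, r))"]
    by (auto intro!: rec_eval_Cn1[where y = "prod_encode (x, prod_encode (k, r))"]
        rec_eval_Cn2[OF _ _ rec_eval_pair] rec_eval_proj)
  have "rec_eval (Pr eg ?s) [k, x] (rec_nat (g x) (h x) k)" for k x
    by (induction k) (simp_all only: nat.rec, rule rec_eval.prec_0[OF eg],
      rule rec_eval.prec_Suc[OF _ s])
  then have "rec_eval (Cn (Pr eg ?s) [en, Proj 0]) [x] (rec_nat (g x) (h x) (n x))" for x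
    using en by (auto intro!: rec_eval_Cn2 rec_eval_proj)
  then show ?thesis unfolding recursive_def by blast
qed


lemma recursive_mult [rec_intros]:
  assumes "recursive f" "recursive g"
  shows "recursive (\<lambda>x. f x * g x)"
proof -
  have *: "n * m = rec_nat 0 (\<lambda>_ r. r + m) n" for n m :: nat
    by (induction n) auto
  have "recursive (\<lambda>x. rec_nat 0 (\<lambda>_ r. r + g x) (f x))"
    \<comment> \<open>Inside the recursion the parameter is \<open>pfst z\<close>, so the hypothesis
      on \<open>g\<close> is needed composed with a projection.\<close>
    by (intro rec_intros assms recursive_comp[OF assms(2)])
  then show ?thesis by (simp add: *)
qed

lemma recursive_power [rec_intros]:
  assumes "recursive f" "recursive g"
  shows "recursive (\<lambda>x. f x ^ g x)"
proof -
  have *: "m ^ n = rec_nat 1 (\<lambda>_ r. m * r) n" for n m :: nat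
    by (induction n) auto
  have "recursive (\<lambda>x. rec_nat 1 (\<lambda>_ r. f x * r) (g x))"
    by (intro rec_intros assms recursive_comp[OF assms(1)])
  then show ?thesis by (simp add: *)
qed

lemma recursive_funpow [rec_intros]:
  assumes "recursive n" "recursive g" "recursive f"
  shows "recursive (\<lambda>x. (f ^^ n x) (g x))"
proof -
  have *: "(f ^^ n) y = rec_nat y (\<lambda>_. f) n" for n and y :: nat
    by (induction n) auto
  have "recursive (\<lambda>x. rec_nat (g x) (\<lambda>_. f) (n x))"
    by (intro rec_intros assms recursive_comp[OF assms(3)])
  then show ?thesis by (simp add: *)
qed

section \<open>Closure properties of decidable predicates\<close>

lemma decidable_less [rec_intros]:
  assumes "recursive f" "recursive g"
  shows "decidable (\<lambda>x. f x < g x)"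
proof -
  \<comment> \<open>With truncated subtraction, \<open>1 - (1 - n)\<close> is the sign of
    \<open>n\<close>.\<close>
  have "recursive (\<lambda>x. 1 - (1 - (g x - f x)))" by (intro rec_intros assms)
  moreover have "1 - (1 - (m - n)) = of_bool (n < m)" for m n :: nat by auto
  ultimately show ?thesis by (simp add: decidable_def)
qed

lemma decidable_not [rec_intros]:
  assumes "decidable P"
  shows "decidable (\<lambda>x. \<not> P x)"
proof -
  have "recursive (\<lambda>x. 1 - of_bool (P x))"
    using assms unfolding decidable_def by (intro rec_intros)
  moreover have "1 - of_bool b = (of_bool (\<not> b) :: nat)" for b by simp
  ultimately show ?thesis by (simp only: decidable_def)
qed

lemma decidable_and [rec_intros]:
  assumes "decidable P" "decidable Q"
  shows "decidable (\<lambda>x. P x \<and> Q x)"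
  using recursive_mult[OF assms[unfolded decidable_def]] by (simp add: decidable_def of_bool_conj)

lemma decidable_imp [rec_intros]:
  assumes "decidable P" "decidable Q"
  shows "decidable (\<lambda>x. P x \<longrightarrow> Q x)"
  using decidable_not[OF decidable_and[OF assms(1) decidable_not[OF assms(2)]]] by simp

lemma decidable_eq [rec_intros]:
  assumes "recursive f" "recursive g"
  shows "decidable (\<lambda>x. f x = g x)"
  using decidable_and[OF decidable_not[OF decidable_less[OF assms]]
      decidable_not[OF decidable_less[OF assms(2,1)]]]
  by (simp add: not_less eq_iff conj_commute)

text \<open>A bounded universal quantifier is the product of the truth values below the bound, and
  this product is a primitive recursion.\<close>

lemma decidable_all_less [rec_intros]:
  assumes "recursive b" "decidable (\<lambda>z. P (pfst z) (psnd z))"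
  shows "decidable (\<lambda>x. \<forall>y<b x. P x y)"
proof -
  have *: "of_bool (\<forall>y<n. P x y) = rec_nat (1::nat) (\<lambda>k r. r * of_bool (P x k)) n" for x n
  proof (induction n)
    case (Suc n)
    have "of_bool (\<forall>y<Suc n. P x y) = of_bool (\<forall>y<n. P x y) * (of_bool (P x n) :: nat)"
      by (auto simp: less_Suc_eq)
    then show ?case by (simp only: Suc nat.rec)
  qed simp
  have "recursive (\<lambda>z. of_bool (P (pfst z) (pfst (psnd z))))"
    using recursive_comp[OF assms(2)[unfolded decidable_def],
      of "\<lambda>z. prod_encode (pfst z, pfst (psnd z))"] by (simp add: rec_intros)
  then have "recursive (\<lambda>x. rec_nat 1 (\<lambda>k r. r * of_bool (P x k)) (b x))"
    by (intro rec_intros assms)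
  then show ?thesis unfolding decidable_def by (simp only: *)
qed

lemma decidable_ex_less [rec_intros]:
  assumes "recursive b" "decidable (\<lambda>z. P (pfst z) (psnd z))"
  shows "decidable (\<lambda>x. \<exists>y<b x. P x y)"
  using decidable_not[OF decidable_all_less[OF assms(1) decidable_not[OF assms(2)]]] by simp

text \<open>Membership tests the bit \<open>n\<close> of the code \<open>s\<close>. Writing
  \<open>s\<close> as an odd multiple of \<open>2 ^ n\<close> plus a remainder expresses this by
  bounded quantifiers, addition, multiplication and powers, without division.\<close>

lemma decidable_in_set_decode [rec_intros]:
  assumes "recursive f" "recursive g"
  shows "decidable (\<lambda>x. f x \<in> set_decode (g x))"
proof -
  have *: "n \<in> set_decode s \<longleftrightarrow>
      (\<exists>q<Suc s. \<exists>r<2 ^ n. s = (2 * q + 1) * 2 ^ n + r)" for n s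
  proof
    assume "n \<in> set_decode s"
    then have "s div 2 ^ n = 2 * (s div 2 ^ n div 2) + 1"
      by (simp add: set_decode_def)
    then have "s = (2 * (s div 2 ^ n div 2) + 1) * 2 ^ n + s mod 2 ^ n"
      by (metis div_mult_mod_eq)
    moreover have "s div 2 ^ n div 2 < Suc s"
      by (meson div_le_dividend le_imp_less_Suc le_trans)
    ultimately show "\<exists>q<Suc s. \<exists>r<2 ^ n. s = (2 * q + 1) * 2 ^ n + r"
      by (metis mod_less_divisor zero_less_numeral zero_less_power)
  next
    assume "\<exists>q<Suc s. \<exists>r<2 ^ n. s = (2 * q + 1) * 2 ^ n + r"
    then obtain q r where "r < 2 ^ n" "s = (2 * q + 1) * 2 ^ n + r" by blast
    then have "s div 2 ^ n = 2 * q + 1" by (simp add: div_add1_eq)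
    then show "n \<in> set_decode s" by (simp add: set_decode_def)
  qed
  show ?thesis unfolding *
    by (intro rec_intros assms recursive_comp[OF assms(1)] recursive_comp[OF assms(2)])
qed
section \<open>Paths in acyclic quivers\<close>

lemma PQ_simps [simp]:
  "verts (PQ k) = {0..k}" "arrs (PQ k) = {0..<k}"
  "i < k \<Longrightarrow> src (PQ k) i = i" "i < k \<Longrightarrow> tgt (PQ k) i = Suc i"
  by (simp_all add: PQ_def)

lemma src_in_verts: "is_quiver Q \<Longrightarrow> a \<in> arrs Q \<Longrightarrow> src Q a \<in> verts Q"
  and tgt_in_verts: "is_quiver Q \<Longrightarrow> a \<in> arrs Q \<Longrightarrow> tgt Q a \<in> verts Q"
  by (auto simp: is_quiver_def)

lemma acyclic_is_quiver: "acyclic_quiver Q \<Longrightarrow> is_quiver Q"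
  by (simp add: acyclic_quiver_def)

lemma is_morD:
  assumes "is_mor m Q Q'"
  shows "v \<in> verts Q \<Longrightarrow> vmap m v \<in> verts Q'"
    and "a \<in> arrs Q \<Longrightarrow> amap m a \<in> arrs Q'"
    and "a \<in> arrs Q \<Longrightarrow> src Q' (amap m a) = vmap m (src Q a)"
    and "a \<in> arrs Q \<Longrightarrow> tgt Q' (amap m a) = vmap m (tgt Q a)"
  using assms by (auto simp: is_mor_def)

lemma mor_eqI:
  assumes "is_mor m Q Q1" "is_mor m' Q Q2"
    and "\<And>v. v \<in> verts Q \<Longrightarrow> vmap m v = vmap m' v"
    and "\<And>a. a \<in> arrs Q \<Longrightarrow> amap m a = amap m' a"
  shows "m = m'"
proof -
  have "vmap m = vmap m'" "amap m = amap m'"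
    using assms unfolding is_mor_def by (auto intro: extensional_eqI)
  then show ?thesis by (simp add: qmor.equality)
qed

lemma mor_comp_simps [simp]:
  "v \<in> verts Q \<Longrightarrow> vmap (mor_comp Q m' m) v = vmap m' (vmap m v)"
  "a \<in> arrs Q \<Longrightarrow> amap (mor_comp Q m' m) a = amap m' (amap m a)"
  by (simp_all add: mor_comp_def compose_def)

lemma is_mor_comp:
  assumes "is_quiver Q" "is_mor m Q Q'" "is_mor m' Q' Q''"
  shows "is_mor (mor_comp Q m' m) Q Q''"
  unfolding is_mor_def
proof (intro conjI ballI)
  show "vmap (mor_comp Q m' m) \<in> verts Q \<rightarrow>\<^sub>E verts Q''"
    using is_morD[OF assms(2)] is_morD[OF assms(3)]
    by (auto simp: mor_comp_def compose_def)
  show "amap (mor_comp Q m' m) \<in> arrs Q \<rightarrow>\<^sub>E arrs Q''"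
    using is_morD[OF assms(2)] is_morD[OF assms(3)]
    by (auto simp: mor_comp_def compose_def)
next
  fix a assume "a \<in> arrs Q"
  then show "src Q'' (amap (mor_comp Q m' m) a) = vmap (mor_comp Q m' m) (src Q a)"
    and "tgt Q'' (amap (mor_comp Q m' m) a) = vmap (mor_comp Q m' m) (tgt Q a)"
    using is_morD[OF assms(2)] is_morD[OF assms(3)] src_in_verts[OF assms(1)] tgt_in_verts[OF assms(1)]
    by simp_all
qed

lemma is_mor_PQ_iff:
  "is_mor p (PQ k) Q \<longleftrightarrow> vmap p \<in> {0..k} \<rightarrow>\<^sub>E verts Q \<and> amap p \<in> {0..<k} \<rightarrow>\<^sub>E arrs Q \<and>
     (\<forall>i<k. src Q (amap p i) = vmap p i \<and> tgt Q (amap p i) = vmap p (Suc i))"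
  by (auto simp: is_mor_def)

lemma is_mor_PQD:
  assumes "is_mor p (PQ k) Q"
  shows "i \<le> k \<Longrightarrow> vmap p i \<in> verts Q" "i < k \<Longrightarrow> amap p i \<in> arrs Q"
    "i < k \<Longrightarrow> src Q (amap p i) = vmap p i" "i < k \<Longrightarrow> tgt Q (amap p i) = vmap p (Suc i)"
  using assms by (auto simp: is_mor_PQ_iff)

lemma is_mor_arrow_mor:
  "is_quiver Q \<Longrightarrow> a \<in> arrs Q \<Longrightarrow> src Q a = u \<Longrightarrow> tgt Q a = v \<Longrightarrow>
   is_mor (arrow_mor a u v) (PQ 1) Q"
  using src_in_verts[of Q a] tgt_in_verts[of Q a]
  by (auto simp: is_mor_PQ_iff arrow_mor_def)

lemma ball_bipaths_iff:
  "(\<forall>((k, p), (l, q))\<in>bipaths Q. P k p l q) \<longleftrightarrow> (\<forall>k p l q. is_mor p (PQ k) Q \<longrightarrow>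
     is_mor q (PQ l) Q \<longrightarrow> vmap p 0 = vmap q 0 \<longrightarrow> vmap p k = vmap q l \<longrightarrow> P k p l q)"
  by (fastforce simp: bipaths_def)

text \<open>The source of the arrow at position \<open>i\<close> is the vertex at position
  \<open>i\<close>, so repeated arrows would give repeated vertices.\<close>

lemma path_amap_inj:
  assumes "is_mor p (PQ k) Q" "inj_on (vmap p) {0..k}"
  shows "inj_on (amap p) {0..<k}"
proof (rule inj_onI)
  fix i j assume ij: "i \<in> {0..<k}" "j \<in> {0..<k}" "amap p i = amap p j"
  then have "vmap p i = vmap p j" using is_mor_PQD(3)[OF assms(1)] by (metis atLeastLessThan_iff)
  then show "i = j" using ij assms(2) by (auto dest: inj_onD)
qed

text \<open>Vertices increase strictly along every path, so none repeats. The concrete quivers below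
  are numbered to meet this criterion.\<close>

lemma acyclic_if_src_less_tgt:
  assumes "is_quiver Q" "\<And>a. a \<in> arrs Q \<Longrightarrow> src Q a < tgt Q a"
  shows "acyclic_quiver Q"
  unfolding acyclic_quiver_def
proof (intro conjI allI impI assms(1))
  fix k p assume p: "is_mor p (PQ k) Q"
  have step: "vmap p i < vmap p (Suc i)" if "i < k" for i
    using assms(2) is_mor_PQD[OF p] that by metis
  have less: "j \<le> k \<Longrightarrow> i < j \<Longrightarrow> vmap p i < vmap p j" for i j
  proof (induction j)
    case (Suc j)
    then show ?case using step[of j] by (cases "i = j") auto
  qed simp
  have "inj_on (vmap p) {0..k}"
    by (rule linorder_inj_onI') (use less in fastforce)
  with path_amap_inj[OF p this] p show "is_embedding p (PQ k) Q" by (simp add: is_embedding_def)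
qed

lemma acyclic_PQ [simp]: "acyclic_quiver (PQ k)"
  by (rule acyclic_if_src_less_tgt) (auto simp: is_quiver_def PQ_def)

lemma path_acyclic_embedding:
  "acyclic_quiver Q \<Longrightarrow> is_mor p (PQ k) Q \<Longrightarrow> acyclic_embedding p (PQ k) Q"
  by (auto simp: acyclic_embedding_def acyclic_quiver_def acyclic_PQ[unfolded acyclic_quiver_def])

lemma path_inj:
  assumes "acyclic_quiver Q" "is_mor p (PQ k) Q"
  shows "inj_on (vmap p) {0..k}" "inj_on (amap p) {0..<k}"
  using path_acyclic_embedding[OF assms] by (auto simp: acyclic_embedding_def is_embedding_def)

lemma path_trivial_iff:
  assumes "acyclic_quiver Q" "is_mor p (PQ k) Q"
  shows "vmap p 0 = vmap p k \<longleftrightarrow> k = 0"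
  using path_inj(1)[OF assms] by (auto dest: inj_onD)

text \<open>No vertex of a path repeats, so the arrow set of a path contains at most one arrow
  leaving a given vertex. Starting from the common first vertex, both paths are therefore forced to
  take the same arrows.\<close>

lemma path_unique:
  assumes Q: "acyclic_quiver Q" and p: "is_mor p (PQ k) Q" and q: "is_mor q (PQ l) Q"
    and start: "vmap p 0 = vmap q 0" and eq: "amap p ` {0..<k} = amap q ` {0..<l}"
  shows "k = l \<and> p = q"
proof -
  have kl: "k = l"
    using arg_cong[OF eq, of card] path_inj(2)[OF Q p] path_inj(2)[OF Q q]
    by (simp add: card_image)
  have same_arrow: "amap p j = amap q j" if "j < k" "vmap p j = vmap q j" for j
  proof -
    have "amap q j \<in> amap p ` {0..<k}" unfolding eq using that(1) kl by simp
    then obtain i where i: "i < k" "amap q j = amap p i" by auto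
    then have "vmap p i = vmap p j"
      using is_mor_PQD(3)[OF p i(1)] is_mor_PQD(3)[OF q, of j] that kl by simp
    then have "i = j" using inj_onD[OF path_inj(1)[OF Q p], of i j] i that by simp
    with i show ?thesis by simp
  qed
  have same_vert: "j \<le> k \<Longrightarrow> vmap p j = vmap q j" for j
  proof (induction j)
    case (Suc j)
    then show ?case
      using same_arrow[of j] is_mor_PQD(4)[OF p, of j] is_mor_PQD(4)[OF q, of j] kl by simp
  qed (rule start)
  have "p = q"
    by (rule mor_eqI[OF p q[folded kl]]) (use same_vert same_arrow in auto)
  with kl show ?thesis by simp
qed

definition path_concat :: "nat \<Rightarrow> nat \<Rightarrow> qmor \<Rightarrow> qmor \<Rightarrow> qmor" where
  "path_concat k l p q =
     \<lparr>vmap = (\<lambda>i\<in>{0..k + l}. if i \<le> k then vmap p i else vmap q (i - k)),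
      amap = (\<lambda>i\<in>{0..<k + l}. if i < k then amap p i else amap q (i - k))\<rparr>"

lemma is_mor_path_concat:
  assumes p: "is_mor p (PQ k) Q" and q: "is_mor q (PQ l) Q" and "vmap p k = vmap q 0"
  shows "is_mor (path_concat k l p q) (PQ (k + l)) Q"
proof -
  \<comment> \<open>The case concerned is \<open>i = k\<close>: there the concatenation takes its
    vertex from \<open>p\<close> but its next arrow from \<open>q\<close>.\<close>
  have "vmap p i = vmap q 0" if "i \<le> k" "\<not> Suc i \<le> k" for i
    using that assms(3) le_antisym[of i k] by (simp add: not_less_eq_eq)
  then show ?thesis
    unfolding is_mor_PQ_iff path_concat_def
    using is_mor_PQD[OF p] is_mor_PQD[OF q] assms(3)
    by (auto simp: not_less Suc_diff_le)
qed

text \<open>Restricting a diagram along the concatenation and then to its two segments gives back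
  the restrictions along \<open>p\<close> and \<open>q\<close>. These are the cospans that
  \<open>EqPathConcat\<close> asks for.\<close>

lemma mor_comp_path_concat:
  assumes p: "is_mor p (PQ k) Q" and q: "is_mor q (PQ l) Q" and "vmap p k = vmap q 0"
  shows "mor_comp (PQ k) (path_concat k l p q) (sp k (k + l)) = p"
    and "mor_comp (PQ l) (path_concat k l p q) (tp l (k + l)) = q"
proof -
  have "vmap p \<in> extensional {0..k}" "amap p \<in> extensional {0..<k}"
    "vmap q \<in> extensional {0..l}" "amap q \<in> extensional {0..<l}"
    using p q by (auto simp: is_mor_PQ_iff PiE_iff)
  then show "mor_comp (PQ k) (path_concat k l p q) (sp k (k + l)) = p"
    "mor_comp (PQ l) (path_concat k l p q) (tp l (k + l)) = q"
    using assms(3)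
    by (auto intro!: qmor.equality ext simp: mor_comp_def path_concat_def sp_def tp_def compose_def
        restrict_def extensional_def)
qed

lemma sp_tp_embedding:
  "k \<le> l \<Longrightarrow> acyclic_embedding (sp k l) (PQ k) (PQ l)"
  "k \<le> l \<Longrightarrow> acyclic_embedding (tp k l) (PQ k) (PQ l)"
  by (auto intro!: path_acyclic_embedding simp: is_mor_PQ_iff sp_def tp_def)

section \<open>Paths as numbers, and the path congruence\<close>

definition is_path :: "quiver \<Rightarrow> nat \<Rightarrow> nat \<Rightarrow> nat \<Rightarrow> nat \<Rightarrow> qmor \<Rightarrow> bool" where
  "is_path Q u v s k p \<longleftrightarrow> is_mor p (PQ k) Q \<and> vmap p 0 = u \<and> vmap p k = v \<and>
     s = set_encode (amap p ` {0..<k})"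

lemma is_path_unique:
  assumes "acyclic_quiver Q" "is_path Q u v s k p" "is_path Q u v' s l q"
  shows "k = l \<and> p = q"
proof -
  have "set_encode (amap p ` {0..<k}) = set_encode (amap q ` {0..<l})"
    using assms(2,3) by (simp add: is_path_def)
  then have "amap p ` {0..<k} = amap q ` {0..<l}"
    by (simp add: set_encode_eq)
  then show ?thesis using assms path_unique by (auto simp: is_path_def)
qed

lemma is_path_concat:
  assumes Q: "acyclic_quiver Q" and p: "is_path Q u v s k p" and q: "is_path Q v w t l q"
  shows "is_path Q u w (s + t) (k + l) (path_concat k l p q)"
proof -
  let ?r = "path_concat k l p q"
  have m: "is_mor p (PQ k) Q" "is_mor q (PQ l) Q" "vmap p k = vmap q 0"
    using p q by (simp_all add: is_path_def)
  note r = is_mor_path_concat[OF m]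
  have am: "i < k \<Longrightarrow> amap ?r i = amap p i" "i < l \<Longrightarrow> amap ?r (k + i) = amap q i" for i
    by (simp_all add: path_concat_def)
  have "{0..<k + l} = {0..<k} \<union> (\<lambda>i. k + i) ` {0..<l}"
    unfolding ivl_disj_un_two(3)[of 0 k "k + l", symmetric, simplified]
    by (simp add: add.commute)
  then have img: "amap ?r ` {0..<k + l} = amap p ` {0..<k} \<union> amap q ` {0..<l}"
    by (simp add: image_Un image_image am del: image_add_atLeastLessThan)
  \<comment> \<open>A common arrow would occur twice in the concatenation, against acyclicity.
    Disjointness is what turns the code of the union into a sum.\<close>
  have "amap p ` {0..<k} \<inter> amap q ` {0..<l} = {}"
  proof (rule ccontr)
    assume "amap p ` {0..<k} \<inter> amap q ` {0..<l} \<noteq> {}"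
    then obtain i j where ij: "i < k" "j < l" "amap p i = amap q j" by auto
    then have "amap ?r i = amap ?r (k + j)" by (simp add: am)
    then have "i = k + j" using inj_onD[OF path_inj(2)[OF Q r], of i "k + j"] ij by simp
    with ij show False by simp
  qed
  then have "set_encode (amap ?r ` {0..<k + l}) = s + t"
    using p q unfolding img by (simp add: is_path_def set_encode_def sum.union_disjoint)
  then show ?thesis using r p q by (auto simp: is_path_def path_concat_def)
qed

text \<open>In an acyclic quiver a path is given by its start and its set of arrows, and the code of a
  concatenation is the sum of the codes. The congruence relates codes \<open>s\<close>, \<open>t\<close> of paths from
  \<open>u\<close> to \<open>v\<close>. It is generated by the pairs of paths whose arrows lie in one of the given
  sets, which are to be the images of the embeddings.\<close>

inductive pcong :: "quiver \<Rightarrow> nat set set \<Rightarrow> nat \<Rightarrow> nat \<Rightarrow> nat \<Rightarrow> nat \<Rightarrow> bool" for Q \<A> where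
  vert: "u \<in> verts Q \<Longrightarrow> pcong Q \<A> u u 0 0"
| arr: "a \<in> arrs Q \<Longrightarrow> pcong Q \<A> (src Q a) (tgt Q a) (2 ^ a) (2 ^ a)"
| sym: "pcong Q \<A> u v s t \<Longrightarrow> pcong Q \<A> u v t s"
| trans: "pcong Q \<A> u v s t \<Longrightarrow> pcong Q \<A> u v t r \<Longrightarrow> pcong Q \<A> u v s r"
| concat: "pcong Q \<A> u v s t \<Longrightarrow> pcong Q \<A> v w s' t' \<Longrightarrow> pcong Q \<A> u w (s + s') (t + t')"
| gen: "A \<in> \<A> \<Longrightarrow> pcong Q \<A> u v s s \<Longrightarrow> pcong Q \<A> u v t t \<Longrightarrow>
    set_decode s \<subseteq> A \<Longrightarrow> set_decode t \<subseteq> A \<Longrightarrow> pcong Q \<A> u v s t"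

text \<open>The induction principle of the congruence, moved from codes to morphisms: a relation on
  paths that respects the rules contains the congruence. It is used with \<open>EqPath\<close>
  between restrictions of a diagram, and with the constantly true relation to see that related codes
  are codes of paths.\<close>

lemma pcong_paths:
  assumes Q: "acyclic_quiver Q"
    and refl: "\<And>k p. is_mor p (PQ k) Q \<Longrightarrow> R k p k p"
    and sym: "\<And>k p l q. is_mor p (PQ k) Q \<Longrightarrow> is_mor q (PQ l) Q \<Longrightarrow> R k p l q \<Longrightarrow> R l q k p"
    and trans: "\<And>k p l q n r. is_mor p (PQ k) Q \<Longrightarrow> is_mor q (PQ l) Q \<Longrightarrow> is_mor r (PQ n) Q \<Longrightarrow>
      R k p l q \<Longrightarrow> R l q n r \<Longrightarrow> R k p n r"
    and conc: "\<And>k p l q k' p' l' q'. is_mor p (PQ k) Q \<Longrightarrow> is_mor q (PQ l) Q \<Longrightarrow>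
      is_mor p' (PQ k') Q \<Longrightarrow> is_mor q' (PQ l') Q \<Longrightarrow>
      vmap p k = vmap p' 0 \<Longrightarrow> vmap q l = vmap q' 0 \<Longrightarrow> R k p l q \<Longrightarrow> R k' p' l' q' \<Longrightarrow>
      R (k + k') (path_concat k k' p p') (l + l') (path_concat l l' q q')"
    and gen: "\<And>A k p l q. A \<in> \<A> \<Longrightarrow> is_mor p (PQ k) Q \<Longrightarrow> is_mor q (PQ l) Q \<Longrightarrow>
      vmap p 0 = vmap q 0 \<Longrightarrow> vmap p k = vmap q l \<Longrightarrow>
      amap p ` {0..<k} \<subseteq> A \<Longrightarrow> amap q ` {0..<l} \<subseteq> A \<Longrightarrow> R k p l q"
  shows "pcong Q \<A> u v s t \<Longrightarrow>
    \<exists>k p l q. is_path Q u v s k p \<and> is_path Q u v t l q \<and> R k p l q"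
proof (induction rule: pcong.induct)
  case (vert u)
  let ?p = "\<lparr>vmap = (\<lambda>i\<in>{0..0}. u), amap = (\<lambda>_. undefined)\<rparr>"
  have "is_path Q u u 0 0 ?p" using vert by (auto simp: is_path_def is_mor_PQ_iff)
  then show ?case using refl unfolding is_path_def by blast
next
  case (arr a)
  let ?p = "arrow_mor a (src Q a) (tgt Q a)"
  have "is_path Q (src Q a) (tgt Q a) (2 ^ a) 1 ?p"
    using is_mor_arrow_mor[OF acyclic_is_quiver[OF Q] arr]
    by (auto simp: is_path_def arrow_mor_def set_encode_def)
  then show ?case using refl unfolding is_path_def by blast
next
  case (sym u v s t)
  then show ?case using assms(3) unfolding is_path_def by blast
next
  case (trans u v s t r)
  then obtain k p l q l' q' n p' where *: "is_path Q u v s k p" "is_path Q u v t l q" "R k p l q"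
    "is_path Q u v t l' q'" "is_path Q u v r n p'" "R l' q' n p'" by blast
  \<comment> \<open>The two induction hypotheses produce separate paths for the middle code
    \<open>t\<close>; a path is determined by its start and its code, so they agree.\<close>
  then have "l' = l" "q' = q" using is_path_unique[OF Q] by blast+
  with * show ?case using assms(4) unfolding is_path_def by blast
next
  case (concat u v s t w s' t')
  then obtain k p l q k' p' l' q' where *: "is_path Q u v s k p" "is_path Q u v t l q" "R k p l q"
    "is_path Q v w s' k' p'" "is_path Q v w t' l' q'" "R k' p' l' q'" by blast
  have "R (k + k') (path_concat k k' p p') (l + l') (path_concat l l' q q')"
    using * by (intro conc) (auto simp: is_path_def)
  then show ?case using * is_path_concat[OF Q] by blast
next
  case (gen A u v s t)
  then obtain k p l q where *: "is_path Q u v s k p" "is_path Q u v t l q" by blast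
  then have "R k p l q"
    using gen.hyps by (intro assms(6)[of A]) (auto simp: is_path_def)
  with * show ?case by blast
qed

definition prefix_code :: "qmor \<Rightarrow> nat \<Rightarrow> nat" where
  "prefix_code p j = set_encode (amap p ` {0..<j})"

lemma prefix_code_Suc:
  assumes "acyclic_quiver Q" "is_mor p (PQ k) Q" "j < k"
  shows "prefix_code p (Suc j) = prefix_code p j + 2 ^ amap p j"
proof -
  have "amap p j \<notin> amap p ` {0..<j}"
    using path_inj(2)[OF assms(1,2)] assms(3) by (auto dest: inj_onD)
  then show ?thesis by (simp add: prefix_code_def atLeast0_lessThan_Suc)
qed

lemma pcong_arrow:
  assumes "is_mor p (PQ k) Q" "j < k"
  shows "pcong Q \<A> (vmap p j) (vmap p (Suc j)) (2 ^ amap p j) (2 ^ amap p j)"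
  using pcong.arr[of "amap p j" Q \<A>] is_mor_PQD[OF assms(1), of j] assms(2) by simp

lemma pcong_prefix:
  assumes Q: "acyclic_quiver Q" and p: "is_mor p (PQ k) Q"
  shows "j \<le> k \<Longrightarrow> pcong Q \<A> (vmap p 0) (vmap p j) (prefix_code p j) (prefix_code p j)"
proof (induction j)
  case 0
  then show ?case using is_mor_PQD(1)[OF p, of 0] by (auto simp: prefix_code_def intro: pcong.vert)
next
  case (Suc j)
  then show ?case
    using pcong.concat[OF Suc.IH pcong_arrow[OF p]] prefix_code_Suc[OF Q p, of j] by simp
qed

text \<open>The path is built up from its start, one arrow at a time. Together with
  \<open>pcong_obtain_path\<close> this makes the diagonal \<open>pcong Q \<A> u v s s\<close> the
  statement that \<open>s\<close> codes a path from \<open>u\<close> to \<open>v\<close>, which is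
  how \<open>gen\<close> and \<open>all_congruent\<close> use it.\<close>

lemma pcong_path_refl:
  assumes Q: "acyclic_quiver Q" and p: "is_path Q u v s k p"
  shows "pcong Q \<A> u v s s"
  using pcong_prefix[OF Q, of p k k] p by (simp add: is_path_def prefix_code_def)

lemma pcong_obtain_path:
  assumes "acyclic_quiver Q" "pcong Q \<A> u v s t"
  obtains k p l q where "is_path Q u v s k p" "is_path Q u v t l q"
  using pcong_paths[OF assms(1), of "\<lambda>_ _ _ _. True" \<A>, OF _ _ _ _ _ assms(2)] by auto

definition all_congruent :: "quiver \<Rightarrow> nat set set \<Rightarrow> bool" where
  "all_congruent Q \<A> \<longleftrightarrow>
     (\<forall>u v s t. pcong Q \<A> u v s s \<longrightarrow> pcong Q \<A> u v t t \<longrightarrow> pcong Q \<A> u v s t)"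

definition images :: "(quiver \<times> qmor) list \<Rightarrow> nat set set" where
  "images ms = (\<lambda>(Q', m). amap m ` arrs Q') ` set ms"

text \<open>The arrow set of a trivial path is empty and lies in every image, even if its vertex
  does not; hence \<open>k \<noteq> 0\<close>. On any other path each vertex is an end of an arrow
  in the image, so it lies in the image as well.\<close>

lemma path_lift:
  assumes Q': "is_quiver Q'" and m: "is_embedding m Q' Q" and p: "is_mor p (PQ k) Q"
    and k: "k \<noteq> 0" and sub: "amap p ` {0..<k} \<subseteq> amap m ` arrs Q'"
  obtains p' where "is_mor p' (PQ k) Q'" "mor_comp (PQ k) m p' = p"
proof
  have mm: "is_mor m Q' Q" and inj: "inj_on (vmap m) (verts Q')" "inj_on (amap m) (arrs Q')"
    using m by (auto simp: is_embedding_def)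
  let ?p' = "\<lparr>vmap = (\<lambda>i\<in>{0..k}. inv_into (verts Q') (vmap m) (vmap p i)),
    amap = (\<lambda>i\<in>{0..<k}. inv_into (arrs Q') (amap m) (amap p i))\<rparr>"
  have a: "\<exists>a\<in>arrs Q'. amap p i = amap m a" if "i < k" for i
    using sub that by (auto simp: image_subset_iff)
  have sv: "vmap p i \<in> vmap m ` verts Q'" "vmap p (Suc i) \<in> vmap m ` verts Q'" if i: "i < k" for i
  proof -
    obtain a where a: "a \<in> arrs Q'" "amap p i = amap m a" using a[OF i] by blast
    then have "vmap p i = vmap m (src Q' a)" "vmap p (Suc i) = vmap m (tgt Q' a)"
      using is_morD(3,4)[OF mm a(1)] is_mor_PQD(3,4)[OF p i] by auto
    then show "vmap p i \<in> vmap m ` verts Q'" "vmap p (Suc i) \<in> vmap m ` verts Q'"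
      using src_in_verts[OF Q' a(1)] tgt_in_verts[OF Q' a(1)] by auto
  qed
  have v: "vmap p i \<in> vmap m ` verts Q'" if "i \<le> k" for i
    using that k sv(1)[of i] sv(2)[of "i - 1"] by (cases "i = k") auto
  show "is_mor ?p' (PQ k) Q'"
    unfolding is_mor_PQ_iff
  proof (intro conjI allI impI)
    show "vmap ?p' \<in> {0..k} \<rightarrow>\<^sub>E verts Q'" using v by (auto intro: inv_into_into)
    show "amap ?p' \<in> {0..<k} \<rightarrow>\<^sub>E arrs Q'" using sub by (auto intro!: inv_into_into)
  next
    fix i assume i: "i < k"
    obtain a where a: "a \<in> arrs Q'" "amap p i = amap m a" using a[OF i] by blast
    then have "vmap p i = vmap m (src Q' a)" "vmap p (Suc i) = vmap m (tgt Q' a)"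
      using is_morD(3,4)[OF mm a(1)] is_mor_PQD(3,4)[OF p i] by auto
    then show "src Q' (amap ?p' i) = vmap ?p' i" "tgt Q' (amap ?p' i) = vmap ?p' (Suc i)"
      using i a inj src_in_verts[OF Q' a(1)] tgt_in_verts[OF Q' a(1)] by simp_all
  qed
  have "amap m (inv_into (arrs Q') (amap m) (amap p i)) = amap p i" if "i < k" for i
    using that sub by (intro f_inv_into_f) auto
  moreover have "vmap m (inv_into (verts Q') (vmap m) (vmap p i)) = vmap p i" if "i \<le> k" for i
    using v[OF that] by (rule f_inv_into_f)
  ultimately show "mor_comp (PQ k) m ?p' = p"
    using p by (auto intro!: qmor.equality ext simp: mor_comp_def compose_def is_mor_PQ_iff PiE_iff
        extensional_def restrict_def)
qed

section \<open>Soundness\<close>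

locale Tcat_model =
  fixes M :: "'a interp"
  assumes Tcat: "is_Tcat_model M"
begin

lemma restr_in_carrier:
  "acyclic_embedding m Q' Q \<Longrightarrow> x \<in> carrier M Q \<Longrightarrow> restr M Q' Q m x \<in> carrier M Q'"
  using Tcat by (auto simp: is_Tcat_model_def is_model_def)

lemma restr_comp:
  "acyclic_embedding m Q Q' \<Longrightarrow> acyclic_embedding m' Q' Q'' \<Longrightarrow> x \<in> carrier M Q'' \<Longrightarrow>
   restr M Q Q' m (restr M Q' Q'' m' x) = restr M Q Q'' (mor_comp Q m' m) x"
  using Tcat unfolding is_Tcat_model_def RestrComp_def by blast

lemma EqPath_sym:
  "x \<in> carrier M (PQ k) \<Longrightarrow> y \<in> carrier M (PQ l) \<Longrightarrow> EqPath M k l x y \<Longrightarrow> EqPath M l k y x"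
  using Tcat unfolding is_Tcat_model_def EqPathSym_def by blast

lemma EqPath_trans:
  "x \<in> carrier M (PQ k) \<Longrightarrow> y \<in> carrier M (PQ l) \<Longrightarrow> z \<in> carrier M (PQ n) \<Longrightarrow>
   EqPath M k l x y \<Longrightarrow> EqPath M l n y z \<Longrightarrow> EqPath M k n x z"
  using Tcat unfolding is_Tcat_model_def EqPathTrans_def by blast

lemma EqPath_concat:
  assumes "x1 \<in> carrier M (PQ k1)" "x2 \<in> carrier M (PQ k2)"
    and "x1' \<in> carrier M (PQ k1')" "x2' \<in> carrier M (PQ k2')"
    and "EqPath M k1 k2 x1 x2" "EqPath M k1' k2' x1' x2'"
    and "restr M (PQ 0) (PQ k1) (tp 0 k1) x1 = restr M (PQ 0) (PQ k1') (sp 0 k1') x1'"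
    and "x1'' \<in> carrier M (PQ (k1 + k1'))" "x2'' \<in> carrier M (PQ (k2 + k2'))"
    and "Cospan M (PQ k1) (PQ k1') (PQ (k1 + k1')) (sp k1 (k1 + k1')) (tp k1' (k1 + k1')) x1 x1' x1''"
    and "Cospan M (PQ k2) (PQ k2') (PQ (k2 + k2')) (sp k2 (k2 + k2')) (tp k2' (k2 + k2')) x2 x2' x2''"
  shows "EqPath M (k1 + k1') (k2 + k2') x1'' x2''"
proof -
  have "EqPathConcat M" using Tcat by (simp add: is_Tcat_model_def)
  note * = this[unfolded EqPathConcat_def, THEN spec[of _ k1], THEN spec[of _ k2],
    THEN spec[of _ k1'], THEN spec[of _ k2'], THEN bspec[OF _ assms(1)], THEN bspec[OF _ assms(2)],
    THEN bspec[OF _ assms(3)], THEN bspec[OF _ assms(4)]]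
  show ?thesis using *[THEN mp, THEN bspec[OF _ assms(8)], THEN bspec[OF _ assms(9)]] assms by simp
qed

lemma commute_iff:
  assumes "acyclic_quiver Q" "x \<in> carrier M Q"
  shows "x \<in> commute M Q \<longleftrightarrow> (\<forall>k p l q. is_mor p (PQ k) Q \<longrightarrow> is_mor q (PQ l) Q \<longrightarrow>
    vmap p 0 = vmap q 0 \<longrightarrow> vmap p k = vmap q l \<longrightarrow>
    EqPath M k l (restr M (PQ k) Q p x) (restr M (PQ l) Q q x))"
  using Tcat assms unfolding is_Tcat_model_def PathCom_def ball_bipaths_iff by blast

lemma Commerge_if_all_congruent:
  assumes inst: "commerge_instance Q ms" and all: "all_congruent Q (images ms)"
  shows "Commerge M Q ms"
  unfolding Commerge_def
proof (intro ballI impI)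
  fix x assume x: "x \<in> carrier M Q"
    and com: "\<forall>i<length ms. restr M (fst (ms ! i)) Q (snd (ms ! i)) x \<in> commute M (fst (ms ! i))"
  have Q: "acyclic_quiver Q" using inst by (simp add: commerge_instance_def)
  let ?x = "\<lambda>k p. restr M (PQ k) Q p x"
  \<comment> \<open>The axioms for reflexivity, symmetry, transitivity and concatenation make
    \<open>R\<close> respect all rules except \<open>gen\<close>; that one comes from commutativity
    of the restrictions to the given subquivers.\<close>
  define R where "R k p l q \<longleftrightarrow> EqPath M k l (?x k p) (?x l q)" for k p l q
  have c: "?x k p \<in> carrier M (PQ k)" if "is_mor p (PQ k) Q" for k p
    using restr_in_carrier path_acyclic_embedding Q x that by blast
  have rc: "restr M (PQ j) (PQ k) m (?x k p) = ?x j (mor_comp (PQ j) p m)"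
    if "acyclic_embedding m (PQ j) (PQ k)" "is_mor p (PQ k) Q" for j k m p
    using restr_comp path_acyclic_embedding Q x that by blast
  have "\<exists>k p l q. is_path Q u v s k p \<and> is_path Q u v t l q \<and> R k p l q"
    if "pcong Q (images ms) u v s t" for u v s t
  proof (rule pcong_paths[OF Q _ _ _ _ _ that])
    fix k p assume "is_mor p (PQ k) Q"
    then show "R k p k p"
      using Tcat c unfolding R_def is_Tcat_model_def EqPathRefl_def by blast
  next
    fix k p l q assume "is_mor p (PQ k) Q" "is_mor q (PQ l) Q" "R k p l q"
    then show "R l q k p" using EqPath_sym c unfolding R_def by blast
  next
    fix k p l q n r assume "is_mor p (PQ k) Q" "is_mor q (PQ l) Q" "is_mor r (PQ n) Q"
      "R k p l q" "R l q n r"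
    then show "R k p n r" using EqPath_trans c unfolding R_def by blast
  next
    fix k p l q k' p' l' q'
    assume m: "is_mor p (PQ k) Q" "is_mor q (PQ l) Q" "is_mor p' (PQ k') Q" "is_mor q' (PQ l') Q"
      and v: "vmap p k = vmap p' 0" "vmap q l = vmap q' 0" and R: "R k p l q" "R k' p' l' q'"
    let ?r = "path_concat k k' p p'" and ?r' = "path_concat l l' q q'"
    have r: "is_mor ?r (PQ (k + k')) Q" "is_mor ?r' (PQ (l + l')) Q"
      using is_mor_path_concat m v by blast+
    have mor0: "is_mor (mor_comp (PQ 0) p (tp 0 k)) (PQ 0) Q"
        "is_mor (mor_comp (PQ 0) p' (sp 0 k')) (PQ 0) Q"
      using m sp_tp_embedding[of 0] acyclic_is_quiver[OF acyclic_PQ]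
      by (auto intro!: is_mor_comp simp: acyclic_embedding_def is_embedding_def)
    \<comment> \<open>Both are the joint of the two paths, seen as a path of length 0. This yields
      the gluing premise of \<open>EqPathConcat\<close>.\<close>
    have "mor_comp (PQ 0) p (tp 0 k) = mor_comp (PQ 0) p' (sp 0 k')"
      by (rule mor_eqI[OF mor0]) (auto simp: v tp_def sp_def)
    then have glue: "restr M (PQ 0) (PQ k) (tp 0 k) (?x k p) = restr M (PQ 0) (PQ k') (sp 0 k') (?x k' p')"
      using rc sp_tp_embedding[of 0] m by simp
    have cs: "Cospan M (PQ k) (PQ k') (PQ (k + k')) (sp k (k + k')) (tp k' (k + k'))
        (?x k p) (?x k' p') (?x (k + k') ?r)"
      "Cospan M (PQ l) (PQ l') (PQ (l + l')) (sp l (l + l')) (tp l' (l + l'))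
        (?x l q) (?x l' q') (?x (l + l') ?r')"
      unfolding Cospan_def using rc sp_tp_embedding r m v by (simp_all add: mor_comp_path_concat)
    show "R (k + k') ?r (l + l') ?r'"
      unfolding R_def
      by (rule EqPath_concat[OF _ _ _ _ R[unfolded R_def] glue _ _ cs]) (simp_all only: c m r)
  next
    fix A k p l q
    assume A: "A \<in> images ms" and p: "is_mor p (PQ k) Q" and q: "is_mor q (PQ l) Q"
      and v: "vmap p 0 = vmap q 0" "vmap p k = vmap q l"
      and sub: "amap p ` {0..<k} \<subseteq> A" "amap q ` {0..<l} \<subseteq> A"
    obtain i Q' m where i: "i < length ms" "ms ! i = (Q', m)" "A = amap m ` arrs Q'"
      using A by (auto simp: images_def in_set_conv_nth)
    then have Q': "acyclic_quiver Q'" and m: "is_embedding m Q' Q"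
      using inst unfolding commerge_instance_def by (metis fst_conv snd_conv)+
    show "R k p l q"
    \<comment> \<open>A trivial path need not lift, but a path parallel to it is the same path, and
      \<open>EqPath\<close> on \<open>PQ 0\<close> is equality.\<close>
    proof (cases "k = 0")
      case True
      then have "l = 0" using v path_trivial_iff[OF Q q] by simp
      moreover have "p = q"
        by (rule mor_eqI[OF p[unfolded True] q[unfolded \<open>l = 0\<close>]]) (use v in auto)
      ultimately show ?thesis using True by (simp add: R_def)
    next
      case False
      then have "l \<noteq> 0" using v path_trivial_iff[OF Q p] by metis
      obtain p' where p': "is_mor p' (PQ k) Q'" "mor_comp (PQ k) m p' = p"
        using path_lift[OF acyclic_is_quiver[OF Q'] m p False] sub i by auto
      obtain q' where q': "is_mor q' (PQ l) Q'" "mor_comp (PQ l) m q' = q"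
        using path_lift[OF acyclic_is_quiver[OF Q'] m q \<open>l \<noteq> 0\<close>] sub i by auto
      have "vmap m (vmap p' 0) = vmap m (vmap q' 0)" "vmap m (vmap p' k) = vmap m (vmap q' l)"
        using v unfolding p'(2)[symmetric] q'(2)[symmetric] by simp_all
      \<comment> \<open>As the embedding is injective on vertices, the lifted paths are parallel
        again, so commutativity in \<open>Q'\<close> applies to them.\<close>
      then have v': "vmap p' 0 = vmap q' 0" "vmap p' k = vmap q' l"
        using m is_mor_PQD(1)[OF p'(1)] is_mor_PQD(1)[OF q'(1)]
        by (auto simp: is_embedding_def dest: inj_onD)
      have ae: "acyclic_embedding m Q' Q" using Q Q' m by (simp add: acyclic_embedding_def)
      have "restr M Q' Q m x \<in> commute M Q'" using com i by (metis fst_conv snd_conv)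
      then have "EqPath M k l (restr M (PQ k) Q' p' (restr M Q' Q m x))
          (restr M (PQ l) Q' q' (restr M Q' Q m x))"
        using commute_iff[OF Q' restr_in_carrier[OF ae x]] p' q' v' by blast
      then show ?thesis
        using restr_comp[OF path_acyclic_embedding[OF Q'] ae x] p' q' by (simp add: R_def)
    qed
  qed
  note eq = this
  show "x \<in> commute M Q"
    unfolding commute_iff[OF Q x]
  proof (intro allI impI)
    fix k p l q assume *: "is_mor p (PQ k) Q" "is_mor q (PQ l) Q" "vmap p 0 = vmap q 0"
      "vmap p k = vmap q l"
    let ?s = "set_encode (amap p ` {0..<k})" and ?t = "set_encode (amap q ` {0..<l})"
    have p: "is_path Q (vmap p 0) (vmap p k) ?s k p" "is_path Q (vmap p 0) (vmap p k) ?t l q"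
      using * by (simp_all add: is_path_def)
    then have "pcong Q (images ms) (vmap p 0) (vmap p k) ?s ?t"
      using all pcong_path_refl[OF Q] unfolding all_congruent_def by blast
    from eq[OF this] show "EqPath M k l (restr M (PQ k) Q p x) (restr M (PQ l) Q q x)"
      using is_path_unique[OF Q] p unfolding R_def by blast
  qed
qed

end
section \<open>Pairs of parallel paths as pushouts\<close>

lemma st_embedding:
  assumes "k \<noteq> 0"
  shows "acyclic_embedding (st k) D2 (PQ k)"
proof -
  have "acyclic_quiver D2" by (rule acyclic_if_src_less_tgt) (auto simp: is_quiver_def D2_def)
  then show ?thesis
    using assms by (auto simp: acyclic_embedding_def is_embedding_def is_mor_def st_def D2_def)
qed

lemma pushout_config_sym:
  "pushout_config Q Q1 Q2 Q' m1 m2 m1' m2' \<Longrightarrow> pushout_config Q Q2 Q1 Q' m2 m1 m2' m1'"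
  unfolding pushout_config_def by (metis Int_commute Un_commute)

text \<open>\<open>parallel_pushout\<close> is picked by \<open>SOME\<close>, so everything must
  follow from the pushout conditions. The goal is that commutativity of such a quiver concerns a
  single pair of paths, namely its two branches.\<close>

locale parallel =
  fixes k l :: nat and Q' :: quiver and m1 m2 :: qmor
  assumes config: "pushout_config D2 (PQ k) (PQ l) Q' (st k) (st l) m1 m2"
    and nontrivial: "k \<noteq> 0" "l \<noteq> 0"
begin

lemma acyclic: "acyclic_quiver Q'"
  and mor1: "is_mor m1 (PQ k) Q'"
  and mor2: "is_mor m2 (PQ l) Q'"
  using config by (auto simp: pushout_config_def acyclic_embedding_def is_embedding_def)

lemma swap: "parallel l k Q' m2 m1"
  unfolding parallel_def using pushout_config_sym[OF config] nontrivial by blast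

lemma ends: "vmap m1 0 = vmap m2 0" "vmap m1 k = vmap m2 l"
proof -
  have "mor_comp D2 m1 (st k) = mor_comp D2 m2 (st l)" using config by (simp add: pushout_config_def)
  then have *: "vmap (mor_comp D2 m1 (st k)) i = vmap (mor_comp D2 m2 (st l)) i" for i by simp
  show "vmap m1 0 = vmap m2 0" "vmap m1 k = vmap m2 l"
    using *[of 0] *[of 1] by (simp_all add: mor_comp_def compose_def st_def D2_def)
qed

lemma meet:
  assumes "i \<le> k" "j \<le> l" "vmap m1 i = vmap m2 j"
  shows "i = 0 \<and> j = 0 \<or> i = k \<and> j = l"
proof -
  have "vmap (mor_comp D2 m1 (st k)) ` verts D2 = vmap m1 ` verts (PQ k) \<inter> vmap m2 ` verts (PQ l)"
    using config unfolding pushout_config_def by blast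
  moreover have "vmap (mor_comp D2 m1 (st k)) ` verts D2 = {vmap m1 0, vmap m1 k}"
    by (auto simp: mor_comp_def compose_def st_def D2_def)
  moreover have "vmap m1 i \<in> vmap m1 ` verts (PQ k)"
    using assms(1) by simp
  moreover have "vmap m1 i \<in> vmap m2 ` verts (PQ l)"
    unfolding assms(3) using assms(2) by simp
  ultimately have "vmap m1 i = vmap m1 0 \<or> vmap m1 i = vmap m1 k" by blast
  then show ?thesis
    using assms ends inj_onD[OF path_inj(1)[OF acyclic mor1], of i]
      inj_onD[OF path_inj(1)[OF acyclic mor2], of j] by auto
qed

lemma arr_cases:
  assumes "a \<in> arrs Q'"
  obtains i where "i < k" "a = amap m1 i" | j where "j < l" "a = amap m2 j"
  using assms config by (auto simp: pushout_config_def)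

text \<open>The branches meet only at their ends. At an inner vertex of a branch the only way on is
  the next arrow, and no arrow leaves the common end.\<close>

lemma outgoing:
  assumes "a \<in> arrs Q'" "src Q' a = vmap m1 i" "0 < i" "i \<le> k"
  shows "i < k \<and> a = amap m1 i"
  using assms(1)
proof (cases rule: arr_cases)
  case (1 j)
  then have "j = i"
    using assms is_mor_PQD(3)[OF mor1] inj_onD[OF path_inj(1)[OF acyclic mor1], of j i] by simp
  with 1 show ?thesis by simp
next
  case (2 j)
  then have "vmap m1 i = vmap m2 j" using assms is_mor_PQD(3)[OF mor2] by simp
  with meet[OF assms(4) _ this] 2 assms(3) show ?thesis by simp
qed

text \<open>Branches diverge only at the common start, so a path that has taken an arrow of a branch
  stays on it.\<close>

lemma follow:
  assumes p: "is_mor p (PQ n) Q'" and "n \<noteq> 0" "i < k" "amap p 0 = amap m1 i"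
  shows "j < n \<Longrightarrow> i + j < k \<and> amap p j = amap m1 (i + j)"
    and "vmap p 0 = vmap m1 i" and "vmap p n = vmap m1 (i + n)" and "i + n \<le> k"
proof -
  show arr: "j < n \<Longrightarrow> i + j < k \<and> amap p j = amap m1 (i + j)" for j
  proof (induction j)
    case (Suc j)
    then have "vmap p (Suc j) = vmap m1 (Suc (i + j))"
      using is_mor_PQD(4)[OF p, of j] is_mor_PQD(4)[OF mor1, of "i + j"] by simp
    then show ?case
      using outgoing[of "amap p (Suc j)" "Suc (i + j)"] Suc is_mor_PQD[OF p, of "Suc j"] by simp
  qed (use assms in simp)
  show "vmap p 0 = vmap m1 i"
    using is_mor_PQD(3)[OF p, of 0] is_mor_PQD(3)[OF mor1, of i] assms by simp
  show "vmap p n = vmap m1 (i + n)" "i + n \<le> k"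
    using arr[of "n - 1"] assms is_mor_PQD(4)[OF p, of "n - 1"]
      is_mor_PQD(4)[OF mor1, of "i + n - 1"] by auto
qed

lemma same_branch:
  assumes p: "is_mor p (PQ n) Q'" "n \<noteq> 0" "i < k" "amap p 0 = amap m1 i"
    and q: "is_mor q (PQ n') Q'" "n' \<noteq> 0" "i' < k" "amap q 0 = amap m1 i'"
    and "vmap p 0 = vmap q 0" "vmap p n = vmap q n'"
  shows "n = n' \<and> (\<forall>j<n. amap p j = amap q j)"
proof -
  note P = follow[OF p] and R = follow[OF q]
  have "i = i'" using P R assms inj_onD[OF path_inj(1)[OF acyclic mor1], of i i'] by simp
  moreover have "i + n = i' + n'"
    using P R assms inj_onD[OF path_inj(1)[OF acyclic mor1], of "i + n" "i' + n'"] by simp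
  ultimately show ?thesis using P(1) R(1) by simp
qed

text \<open>A vertex on both branches that an arrow leaves is the common start, and one that an
  arrow enters is the common end. So both paths run through their entire branch.\<close>

lemma different_branch:
  assumes p: "is_mor p (PQ n) Q'" "n \<noteq> 0" "i < k" "amap p 0 = amap m1 i"
    and q: "is_mor q (PQ n') Q'" "n' \<noteq> 0" "j < l" "amap q 0 = amap m2 j"
    and "vmap p 0 = vmap q 0" "vmap p n = vmap q n'"
  shows "n = k \<and> n' = l \<and> (\<forall>j<k. amap p j = amap m1 j) \<and> (\<forall>j<l. amap q j = amap m2 j)"
proof -
  note P = follow[OF p] and R = parallel.follow[OF swap q]
  have ij: "i = 0" "j = 0" using meet[of i j] P R assms by auto
  moreover have "n = k" "n' = l" using meet[of "i + n" "j + n'"] ij P R assms by auto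
  ultimately show ?thesis using P(1) R(1) by simp
qed

text \<open>The cases speak of arrows only, which is enough to compare products of arrow
  labels.\<close>

lemma bipath_cases:
  assumes p: "is_mor p (PQ n) Q'" and q: "is_mor q (PQ n') Q'"
    and v: "vmap p 0 = vmap q 0" "vmap p n = vmap q n'"
  obtains (same) "n = n'" "\<forall>j<n. amap p j = amap q j"
  | (m1m2) "n = k" "n' = l" "\<forall>j<k. amap p j = amap m1 j" "\<forall>j<l. amap q j = amap m2 j"
  | (m2m1) "n = l" "n' = k" "\<forall>j<l. amap p j = amap m2 j" "\<forall>j<k. amap q j = amap m1 j"
proof (cases "n = 0")
  case True
  then have "n' = 0" using v path_trivial_iff[OF acyclic q] by simp
  with True show ?thesis using same by simp
next
  case False
  then have n': "n' \<noteq> 0" using v path_trivial_iff[OF acyclic p] by metis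
  have arrs: "amap p 0 \<in> arrs Q'" "amap q 0 \<in> arrs Q'"
    using is_mor_PQD(2)[OF p] is_mor_PQD(2)[OF q] False n' by auto
  from arrs(1) show ?thesis
  proof (cases rule: arr_cases)
    case p0: (1 i)
    from arrs(2) show ?thesis
    proof (cases rule: arr_cases)
      case (1 j)
      from same_branch[OF p False p0 q n' this v] same show ?thesis by blast
    next
      case (2 j)
      from different_branch[OF p False p0 q n' this v] m1m2 show ?thesis by blast
    qed
  next
    case p0: (2 i)
    from arrs(2) show ?thesis
    proof (cases rule: arr_cases)
      case (1 j)
      from parallel.different_branch[OF swap p False p0 q n' this v] m2m1 show ?thesis by blast
    next
      case (2 j)
      from parallel.same_branch[OF swap p False p0 q n' this v] same show ?thesis by blast
    qed
  qed
qed

end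

text \<open>The two paths are glued to \<open>0 \<rightarrow> 1 \<rightarrow> \<dots> \<rightarrow> k - 1 \<rightarrow> k + l\<close> and
  \<open>0 \<rightarrow> k + 1 \<rightarrow> \<dots> \<rightarrow> k + l\<close>, so that arrows increase vertices.\<close>

lemma parallel_exists:
  assumes "k \<noteq> 0" "l \<noteq> 0"
  shows "\<exists>Q' m1 m2. pushout_config D2 (PQ k) (PQ l) Q' (st k) (st l) m1 m2"
proof -
  define f1 where "f1 i = (if i < k then i else k + l)" for i
  define f2 where "f2 i = (if i = 0 then 0 else k + i)" for i
  define Q' where "Q' = \<lparr>verts = f1 ` {0..k} \<union> f2 ` {0..l}, arrs = {0..<k + l},
    src = (\<lambda>a\<in>{0..<k + l}. if a < k then f1 a else f2 (a - k)),
    tgt = (\<lambda>a\<in>{0..<k + l}. if a < k then f1 (Suc a) else f2 (Suc (a - k)))\<rparr>"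
  define m1 where "m1 = \<lparr>vmap = restrict f1 {0..k}, amap = (\<lambda>i\<in>{0..<k}. i)\<rparr>"
  define m2 where "m2 = \<lparr>vmap = restrict f2 {0..l}, amap = (\<lambda>i\<in>{0..<l}. k + i)\<rparr>"
  have Q': "acyclic_quiver Q'"
  proof (rule acyclic_if_src_less_tgt)
    show "is_quiver Q'" by (auto simp: is_quiver_def Q'_def)
    fix a assume "a \<in> arrs Q'"
    then show "src Q' a < tgt Q' a" by (auto simp: Q'_def f1_def f2_def)
  qed
  have m1: "acyclic_embedding m1 (PQ k) Q'"
    by (rule path_acyclic_embedding[OF Q']) (auto simp: is_mor_PQ_iff m1_def Q'_def)
  have m2: "acyclic_embedding m2 (PQ l) Q'"
    by (rule path_acyclic_embedding[OF Q']) (auto simp: is_mor_PQ_iff m2_def Q'_def)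
  have f_eq: "f1 i = f2 j \<Longrightarrow> i \<le> k \<Longrightarrow> j \<le> l \<Longrightarrow> i = 0 \<and> j = 0 \<or> i = k \<and> j = l" for i j
    by (auto simp: f1_def f2_def split: if_splits)
  have f_ends: "f1 0 = f2 0" "f1 k = f2 l" using assms by (simp_all add: f1_def f2_def)
  have "mor_comp D2 m1 (st k) = mor_comp D2 m2 (st l)"
    using f_ends by (auto intro!: qmor.equality ext simp: mor_comp_def compose_def m1_def m2_def st_def D2_def
        restrict_def)
  moreover have "arrs Q' = amap m1 ` arrs (PQ k) \<union> amap m2 ` arrs (PQ l)"
    by (auto simp: Q'_def m1_def m2_def image_iff Bex_def)
  moreover have "vmap (mor_comp D2 m1 (st k)) ` verts D2 = vmap m1 ` verts (PQ k) \<inter> vmap m2 ` verts (PQ l)"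
  proof -
    have "vmap (mor_comp D2 m1 (st k)) ` verts D2 = {f1 0, f1 k}"
      by (auto simp: mor_comp_def compose_def st_def D2_def m1_def)
    moreover have "f1 ` {0..k} \<inter> f2 ` {0..l} = {f1 0, f1 k}"
      using f_eq f_ends by fastforce
    ultimately show ?thesis by (simp add: m1_def m2_def)
  qed
  moreover have "amap (mor_comp D2 m1 (st k)) ` arrs D2 = amap m1 ` arrs (PQ k) \<inter> amap m2 ` arrs (PQ l)"
    by (auto simp: m1_def m2_def D2_def)
  moreover have "verts Q' = vmap m1 ` verts (PQ k) \<union> vmap m2 ` verts (PQ l)"
    by (simp add: Q'_def m1_def m2_def)
  ultimately have "pushout_config D2 (PQ k) (PQ l) Q' (st k) (st l) m1 m2"
    using m1 m2 st_embedding assms unfolding pushout_config_def by simp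
  then show ?thesis by blast
qed

lemma parallel_pushout:
  assumes "k \<noteq> 0" "l \<noteq> 0" "parallel_pushout k l = (Q', m1, m2)"
  shows "parallel k l Q' m1 m2"
proof -
  have "case parallel_pushout k l of (Q', m1, m2) \<Rightarrow>
      pushout_config D2 (PQ k) (PQ l) Q' (st k) (st l) m1 m2"
    unfolding parallel_pushout_def
    by (rule someI_ex) (use parallel_exists[OF assms(1,2)] in auto)
  with assms show ?thesis by (simp add: parallel_def)
qed

text \<open>The two-step side of the triangle consists of the arrows 0 and 2, whence the factor
  2.\<close>

definition triangle_path :: qmor where
  "triangle_path = \<lparr>vmap = (\<lambda>i\<in>{0..2}. i), amap = (\<lambda>i\<in>{0..<2}. 2 * i)\<rparr>"

lemma atLeastAtMost_two: "{0..2} = {0, 1, 2 :: nat}"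
  and atLeastLessThan_two: "{0..<2} = {0, 1 :: nat}"
  by auto

lemma acyclic_TQ: "acyclic_quiver TQ"
  by (rule acyclic_if_src_less_tgt) (auto simp: is_quiver_def TQ_def)

text \<open>The triangle is itself a gluing of a path of length 2 and one of length 1 along their
  ends. Commutativity in \<open>Comp\<close> is thus covered by the analysis of parallel
  branches.\<close>

lemma parallel_TQ: "parallel 2 1 TQ triangle_path e02"
proof
  have m1: "acyclic_embedding triangle_path (PQ 2) TQ"
    by (rule path_acyclic_embedding[OF acyclic_TQ])
      (auto simp: is_mor_PQ_iff triangle_path_def TQ_def atLeastAtMost_two atLeastLessThan_two less_2_cases_iff)
  have m2: "acyclic_embedding e02 (PQ 1) TQ"
    by (rule path_acyclic_embedding[OF acyclic_TQ])
      (auto simp: is_mor_PQ_iff e02_def arrow_mor_def TQ_def)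
  have "mor_comp D2 triangle_path (st 2) = mor_comp D2 e02 (st 1)"
    by (auto intro!: qmor.equality ext
        simp: mor_comp_def compose_def triangle_path_def e02_def arrow_mor_def st_def D2_def restrict_def)
  moreover have "vmap triangle_path ` verts (PQ 2) = {0, 1, 2}" "amap triangle_path ` arrs (PQ 2) = {0, 2}"
    by (auto simp: triangle_path_def atLeastAtMost_two atLeastLessThan_two)
  moreover have "vmap e02 ` verts (PQ 1) = {0, 2}" "amap e02 ` arrs (PQ 1) = {1}"
    by (auto simp: e02_def arrow_mor_def image_iff)
  moreover have "vmap (mor_comp D2 triangle_path (st 2)) ` verts D2 = {0, 2}"
    by (auto simp: mor_comp_def compose_def triangle_path_def st_def D2_def)
  moreover have "amap (mor_comp D2 triangle_path (st 2)) ` arrs D2 = {}" by (simp add: D2_def)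
  moreover have "verts TQ = {0, 1, 2} \<union> {0, 2}" "arrs TQ = {0, 2} \<union> {1}" by (auto simp: TQ_def)
  moreover have "{0, 2} = {0, 1, 2} \<inter> {0, 2 :: nat}" "{} = {0, 2} \<inter> {1 :: nat}" by auto
  ultimately show "pushout_config D2 (PQ 2) (PQ 1) TQ (st 2) (st 1) triangle_path e02"
    using m1 m2 st_embedding[of 2] st_embedding[of 1]
    unfolding pushout_config_def by (simp del: mor_comp_simps)
qed simp_all

section \<open>Models from monoids\<close>

text \<open>Countability allows a labelling of finitely many arrows to be coded by one number, so
  that the model lives over \<open>nat\<close>.\<close>

locale countable_monoid =
  fixes U :: "'b :: countable set" and mult :: "'b \<Rightarrow> 'b \<Rightarrow> 'b" (infixl "\<odot>" 70) and one :: 'b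
  assumes mult_closed: "x \<in> U \<Longrightarrow> y \<in> U \<Longrightarrow> x \<odot> y \<in> U"
    and one_closed [simp]: "one \<in> U"
    and assoc: "x \<in> U \<Longrightarrow> y \<in> U \<Longrightarrow> z \<in> U \<Longrightarrow> x \<odot> y \<odot> z = x \<odot> (y \<odot> z)"
    and left_one [simp]: "x \<in> U \<Longrightarrow> one \<odot> x = x"
    and right_one [simp]: "x \<in> U \<Longrightarrow> x \<odot> one = x"
begin

primrec path_prod :: "(nat \<Rightarrow> 'b) \<Rightarrow> nat \<Rightarrow> 'b" where
  "path_prod f 0 = one"
| "path_prod f (Suc n) = path_prod f n \<odot> f n"

lemma path_prod_cong: "(\<And>i. i < n \<Longrightarrow> f i = g i) \<Longrightarrow> path_prod f n = path_prod g n"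
  by (induction n) auto

lemma path_prod_closed: "(\<And>i. i < n \<Longrightarrow> f i \<in> U) \<Longrightarrow> path_prod f n \<in> U"
  by (induction n) (auto simp: mult_closed)

lemma path_prod_add:
  "(\<And>i. i < m + n \<Longrightarrow> f i \<in> U) \<Longrightarrow>
   path_prod f (m + n) = path_prod f m \<odot> path_prod (\<lambda>i. f (m + i)) n"
  by (induction n) (simp_all add: path_prod_closed assoc)

text \<open>The category of the model is the monoid, with its single object. A diagram of shape \<open>Q\<close>
  is thus a labelling of the arrows of \<open>Q\<close>.\<close>

definition code :: "quiver \<Rightarrow> (nat \<Rightarrow> 'b) \<Rightarrow> nat" where
  "code Q f = fun_code (arrs Q) (to_nat \<circ> f)"

text \<open>Decoding refers to no quiver, so restriction can be computed from the number and the
  embedding alone.\<close>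

definition label :: "nat \<Rightarrow> nat \<Rightarrow> 'b" where
  "label c a = (THE y. prod_encode (a, to_nat y) \<in> set_decode c)"

definition diagrams :: "quiver \<Rightarrow> nat set" where
  "diagrams Q = code Q ` (arrs Q \<rightarrow> U)"

text \<open>Commutativity is defined by equality of products along all parallel paths. As
  \<open>EqPath\<close> is derived from \<open>commute\<close>, it has to be shown that
  \<open>EqPath\<close> again means equality of products; then \<open>PathCom\<close> holds.\<close>

definition model :: "nat interp" where
  "model = \<lparr>carrier = diagrams, restr = (\<lambda>Q' Q m c. code Q' (label c \<circ> amap m)),
     commute = (\<lambda>Q. {c \<in> diagrams Q. \<forall>((k, p), (l, q))\<in>bipaths Q.
       path_prod (label c \<circ> amap p) k = path_prod (label c \<circ> amap q) l})\<rparr>"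

lemma carrier_model [simp]: "carrier model = diagrams"
  by (simp add: model_def)

lemma code_cong: "(\<And>a. a \<in> arrs Q \<Longrightarrow> f a = g a) \<Longrightarrow> code Q f = code Q g"
  by (auto simp: code_def fun_code_def intro!: arg_cong[of _ _ set_encode])

lemma label_code [simp]:
  assumes "acyclic_quiver Q" "a \<in> arrs Q"
  shows "label (code Q f) a = f a"
proof -
  have "finite (arrs Q)" using acyclic_is_quiver[OF assms(1)] by (simp add: is_quiver_def)
  then have "prod_encode (a, to_nat y) \<in> set_decode (code Q f) \<longleftrightarrow> y = f a" for y
    using assms(2) by (auto simp: code_def fun_code_def set_encode_inverse image_iff)
  then show ?thesis by (simp add: label_def)
qed

lemma code_in_diagrams: "(\<And>a. a \<in> arrs Q \<Longrightarrow> f a \<in> U) \<Longrightarrow> code Q f \<in> diagrams Q"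
  by (auto simp: diagrams_def)

lemma label_closed:
  "acyclic_quiver Q \<Longrightarrow> c \<in> diagrams Q \<Longrightarrow> a \<in> arrs Q \<Longrightarrow> label c a \<in> U"
  by (auto simp: diagrams_def)

lemma diagram_eqI:
  assumes "acyclic_quiver Q" "c \<in> diagrams Q" "c' \<in> diagrams Q"
    and "\<And>a. a \<in> arrs Q \<Longrightarrow> label c a = label c' a"
  shows "c = c'"
proof -
  obtain f f' where "c = code Q f" "c' = code Q f'" using assms by (auto simp: diagrams_def)
  then show ?thesis using assms by (auto intro!: code_cong)
qed

lemma label_restr [simp]:
  "acyclic_quiver Q' \<Longrightarrow> a \<in> arrs Q' \<Longrightarrow> label (restr model Q' Q m c) a = label c (amap m a)"
  by (simp add: model_def)

lemma restr_in_diagrams: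
  assumes "acyclic_quiver Q" "is_mor m Q' Q" "c \<in> diagrams Q"
  shows "restr model Q' Q m c \<in> diagrams Q'"
  using assms is_morD(2)[OF assms(2)] label_closed
  by (auto simp: model_def intro!: code_in_diagrams)

lemma commute_iff:
  "c \<in> commute model Q \<longleftrightarrow> c \<in> diagrams Q \<and>
     (\<forall>k p l q. is_mor p (PQ k) Q \<longrightarrow> is_mor q (PQ l) Q \<longrightarrow> vmap p 0 = vmap q 0 \<longrightarrow>
       vmap p k = vmap q l \<longrightarrow> path_prod (label c \<circ> amap p) k = path_prod (label c \<circ> amap q) l)"
  by (simp add: model_def ball_bipaths_iff)

text \<open>Every arrow of \<open>Q'\<close> comes from \<open>Q1\<close> or \<open>Q2\<close>, so
  its label is forced. An arrow from both comes from \<open>Q\<close>, where the given labels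
  agree.\<close>

lemma PushoutEU_model: "PushoutEU model"
  unfolding PushoutEU_def
proof (intro allI impI ballI)
  fix Q Q1 Q2 Q' m1 m2 m1' m2' x1 x2
  assume config: "pushout_config Q Q1 Q2 Q' m1 m2 m1' m2'"
    and "x1 \<in> carrier model Q1" "x2 \<in> carrier model Q2"
    and eq: "restr model Q Q1 m1 x1 = restr model Q Q2 m2 x2"
  then have x: "x1 \<in> diagrams Q1" "x2 \<in> diagrams Q2" by simp_all
  note cfg = config[unfolded pushout_config_def acyclic_embedding_def is_embedding_def]
  have ac: "acyclic_quiver Q" "acyclic_quiver Q1" "acyclic_quiver Q2" "acyclic_quiver Q'"
    and mor: "is_mor m1 Q Q1" "is_mor m2 Q Q2" "is_mor m1' Q1 Q'" "is_mor m2' Q2 Q'"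
    and inj: "inj_on (amap m1') (arrs Q1)" "inj_on (amap m2') (arrs Q2)"
    and cover: "arrs Q' = amap m1' ` arrs Q1 \<union> amap m2' ` arrs Q2"
    using cfg by - (elim conjE, assumption)+
  have glue: "mor_comp Q m1' m1 = mor_comp Q m2' m2"
    and meet: "amap (mor_comp Q m1' m1) ` arrs Q = amap m1' ` arrs Q1 \<inter> amap m2' ` arrs Q2"
    using cfg by - (elim conjE, assumption)+
  define f where "f a = (if a \<in> amap m1' ` arrs Q1 then label x1 (inv_into (arrs Q1) (amap m1') a)
    else label x2 (inv_into (arrs Q2) (amap m2') a))" for a
  have f1: "f (amap m1' a) = label x1 a" if "a \<in> arrs Q1" for a
    using that inj by (simp add: f_def)
  have f2: "f (amap m2' a) = label x2 a" if a: "a \<in> arrs Q2" for a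
  proof (cases "amap m2' a \<in> amap m1' ` arrs Q1")
    case True
    then have "amap m2' a \<in> amap (mor_comp Q m1' m1) ` arrs Q" using a meet by blast
    then obtain b where b: "b \<in> arrs Q" "amap m2' a = amap (mor_comp Q m1' m1) b" by auto
    have "amap (mor_comp Q m1' m1) b = amap (mor_comp Q m2' m2) b" unfolding glue ..
    then have 1: "amap m2' a = amap m1' (amap m1 b)" and "amap m2' a = amap m2' (amap m2 b)"
      using b by simp_all
    then have 2: "a = amap m2 b" using inj_onD[OF inj(2), of a "amap m2 b"] a is_morD(2)[OF mor(2) b(1)] by simp
    have "label x1 (amap m1 b) = label x2 (amap m2 b)"
      using arg_cong[OF eq, of "\<lambda>c. label c b"] ac b by simp
    then show ?thesis using 1 2 f1 is_morD(2)[OF mor(1) b(1)] by simp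
  qed (use a inj in \<open>simp add: f_def\<close>)
  show "\<exists>!x'. x' \<in> carrier model Q' \<and> Cospan model Q1 Q2 Q' m1' m2' x1 x2 x'"
  proof (rule ex1I)
    have c: "code Q' f \<in> diagrams Q'"
      using cover f1 f2 label_closed[OF ac(2) x(1)] label_closed[OF ac(3) x(2)]
      by (auto intro!: code_in_diagrams)
    have "restr model Q1 Q' m1' (code Q' f) = x1" "restr model Q2 Q' m2' (code Q' f) = x2"
      using ac f1 f2 is_morD(2)[OF mor(3)] is_morD(2)[OF mor(4)]
      by (auto intro!: diagram_eqI[OF ac(2) _ x(1)] diagram_eqI[OF ac(3) _ x(2)]
          restr_in_diagrams[OF ac(4) _ c] mor)
    with c show "code Q' f \<in> carrier model Q' \<and> Cospan model Q1 Q2 Q' m1' m2' x1 x2 (code Q' f)"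
      by (simp add: Cospan_def)
  next
    fix x' assume "x' \<in> carrier model Q' \<and> Cospan model Q1 Q2 Q' m1' m2' x1 x2 x'"
    then have x': "x' \<in> diagrams Q'" "restr model Q1 Q' m1' x' = x1" "restr model Q2 Q' m2' x' = x2"
      by (simp_all add: Cospan_def)
    have "label x' a = f a" if "a \<in> arrs Q'" for a
      using that cover f1 f2 ac unfolding x'(2,3)[symmetric] by auto
    then show "x' = code Q' f"
      using ac x' cover f1 f2 label_closed[OF ac(2) x(1)] label_closed[OF ac(3) x(2)]
      by (auto intro!: diagram_eqI[OF ac(4)] code_in_diagrams)
  qed
qed

lemma parallel_commute_iff:
  assumes "parallel k l Q' m1 m2" "c \<in> diagrams Q'"
  shows "c \<in> commute model Q' \<longleftrightarrow>
    path_prod (label c \<circ> amap m1) k = path_prod (label c \<circ> amap m2) l"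
proof
  interpret parallel k l Q' m1 m2 by fact
  show "path_prod (label c \<circ> amap m1) k = path_prod (label c \<circ> amap m2) l"
    if "c \<in> commute model Q'"
    using that mor1 mor2 ends unfolding commute_iff by blast
  assume eq: "path_prod (label c \<circ> amap m1) k = path_prod (label c \<circ> amap m2) l"
  show "c \<in> commute model Q'"
    unfolding commute_iff
  proof (intro conjI allI impI assms(2))
    fix n p n' q
    assume p: "is_mor p (PQ n) Q'" and q: "is_mor q (PQ n') Q'"
      and v: "vmap p 0 = vmap q 0" "vmap p n = vmap q n'"
    have cong: "path_prod (label c \<circ> amap r) j = path_prod (label c \<circ> amap r') j"
      if "\<forall>i<j. amap r i = amap r' i" for r r' j
      using that by (auto intro!: path_prod_cong)
    from p q v show "path_prod (label c \<circ> amap p) n = path_prod (label c \<circ> amap q) n'"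
      by (cases rule: bipath_cases) (use eq cong in metis)+
  qed
qed

lemma path_prod_restr:
  assumes "is_mor p (PQ k) Q"
  shows "path_prod (label (restr model (PQ k) Q p c)) k = path_prod (label c \<circ> amap p) k"
  by (rule path_prod_cong) simp

text \<open>\<open>D2\<close> has no arrows, so the end point condition is automatic. The quantifier
  over glued diagrams is not vacuous since pushouts exist, and every such diagram gives the same
  equation.\<close>

lemma EqPath_nontriv_iff:
  assumes "k \<noteq> 0" "l \<noteq> 0" and x: "x \<in> diagrams (PQ k)" and y: "y \<in> diagrams (PQ l)"
  shows "EqPath_nontriv model k l x y \<longleftrightarrow> path_prod (label x) k = path_prod (label y) l"
proof -
  obtain Q' m1 m2 where pp: "parallel_pushout k l = (Q', m1, m2)" by (metis prod_cases3)
  interpret parallel k l Q' m1 m2 by (rule parallel_pushout[OF assms(1,2) pp])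
  have D2: "restr model D2 (PQ k) (st k) x = restr model D2 (PQ l) (st l) y"
    by (simp add: model_def D2_def code_def fun_code_def)
  then obtain c where c: "c \<in> diagrams Q'" "Cospan model (PQ k) (PQ l) Q' m1 m2 x y c"
    using PushoutEU_model config x y unfolding PushoutEU_def carrier_model by blast
  have *: "c \<in> commute model Q' \<longleftrightarrow> path_prod (label x) k = path_prod (label y) l"
    if "c \<in> diagrams Q'" "Cospan model (PQ k) (PQ l) Q' m1 m2 x y c" for c
    using that parallel_commute_iff[OF parallel_axioms that(1)]
      path_prod_restr[OF mor1, of c] path_prod_restr[OF mor2, of c] by (simp add: Cospan_def)
  show ?thesis unfolding EqPath_nontriv_def pp using D2 c * by auto
qed

lemma Comp_iff:
  assumes x: "x \<in> diagrams (PQ 1)" and y: "y \<in> diagrams (PQ 1)" and z: "z \<in> diagrams (PQ 1)"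
  shows "Comp model x y z \<longleftrightarrow> label z 0 = label x 0 \<odot> label y 0"
proof -
  have e: "amap e01 0 = 0" "amap e12 0 = 2" "amap e02 0 = 1"
    by (simp_all add: e01_def e12_def e02_def arrow_mor_def)
  have "restr model (PQ 1) TQ m w = u \<longleftrightarrow> label u 0 = label w (amap m 0)"
    if m: "m = e01 \<or> m = e12 \<or> m = e02" and w: "w \<in> diagrams TQ" and u: "u \<in> diagrams (PQ 1)"
    for m w u
  proof
    have "is_mor m (PQ 1) TQ"
      using m acyclic_is_quiver[OF acyclic_TQ] unfolding e01_def e12_def e02_def
      by (auto intro!: is_mor_arrow_mor simp del: One_nat_def) (simp_all add: TQ_def)
    then have r: "restr model (PQ 1) TQ m w \<in> diagrams (PQ 1)"
      by (rule restr_in_diagrams[OF acyclic_TQ _ w])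
    show "restr model (PQ 1) TQ m w = u" if "label u 0 = label w (amap m 0)"
      using that by (intro diagram_eqI[OF acyclic_PQ r u]) simp
    show "label u 0 = label w (amap m 0)" if "restr model (PQ 1) TQ m w = u"
      unfolding that[symmetric] by simp
  qed
  note r = this
  have com: "w \<in> commute model TQ \<longleftrightarrow> label w 0 \<odot> label w 2 = label w 1" if w: "w \<in> diagrams TQ" for w
  proof -
    have "label w 0 \<in> U" "label w 1 \<in> U" "label w 2 \<in> U"
      using label_closed[OF acyclic_TQ w] by (simp_all add: TQ_def)
    then show ?thesis
      using parallel_commute_iff[OF parallel_TQ w]
      by (simp add: numeral_2_eq_2 triangle_path_def e)
  qed
  \<comment> \<open>Arrows 0 and 2 of \<open>TQ\<close> carry the factors, and arrow 1 carries the
    composite.\<close>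
  let ?w = "code TQ (\<lambda>a. if a = 0 then label x 0 else if a = 1 then label z 0 else label y 0)"
  have w: "?w \<in> diagrams TQ"
    using label_closed[OF acyclic_PQ x, of 0] label_closed[OF acyclic_PQ y, of 0]
      label_closed[OF acyclic_PQ z, of 0] by (auto intro!: code_in_diagrams)
  have lw: "label ?w 0 = label x 0" "label ?w 1 = label z 0" "label ?w 2 = label y 0"
    by (subst label_code[OF acyclic_TQ]; simp add: TQ_def)+
  show ?thesis
  proof
    assume "Comp model x y z"
    then obtain w where "w \<in> diagrams TQ" "restr model (PQ 1) TQ e01 w = x"
      "restr model (PQ 1) TQ e12 w = y" "restr model (PQ 1) TQ e02 w = z" "w \<in> commute model TQ"
      unfolding Comp_def by auto
    then show "label z 0 = label x 0 \<odot> label y 0" using r[of _ w] com x y z e by auto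
  next
    assume "label z 0 = label x 0 \<odot> label y 0"
    then show "Comp model x y z"
      unfolding Comp_def carrier_model using w r[OF _ w] com[OF w] x y z e lw
      by (intro bexI[OF _ w]) auto
  qed
qed

lemma single_arrow: "x \<in> diagrams (PQ 1) \<Longrightarrow> path_prod (label x) 1 = label x 0"
  using label_closed[of "PQ 1" x 0] by simp

lemma single_code: "u \<in> U \<Longrightarrow> code (PQ 1) (\<lambda>_. u) \<in> diagrams (PQ 1)"
  "label (code (PQ 1) (\<lambda>_. u)) 0 = u"
  by (auto intro!: code_in_diagrams)

lemma diagrams_no_arrows: "arrs Q = {} \<Longrightarrow> diagrams Q = {0}"
  by (auto simp: diagrams_def code_def fun_code_def)

lemma Ident_iff:
  assumes x: "x \<in> diagrams (PQ 0)" and y: "y \<in> diagrams (PQ 1)"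
  shows "Ident model x y \<longleftrightarrow> label y 0 = one"
proof
  have U: "label u 0 \<in> U" if "u \<in> diagrams (PQ 1)" for u
    using label_closed[OF acyclic_PQ that] by simp
  show "label y 0 = one" if "Ident model x y"
  proof -
    \<comment> \<open>The unit itself serves as test arrow: composing \<open>y\<close> with it gives
      \<open>y\<close>, so the defining property of an identity equates \<open>one\<close> with the
      label of \<open>y\<close>.\<close>
    let ?z = "code (PQ 1) (\<lambda>_. one)"
    have "Comp model y ?z y"
      using Comp_iff[of y ?z y] y U single_code by (simp del: One_nat_def)
    then have "EqPath_nontriv model 1 1 ?z y"
      using that y single_code unfolding Ident_def by simp
    then have "path_prod (label ?z) 1 = path_prod (label y) 1"
      using EqPath_nontriv_iff[of 1 1 ?z y] y single_code by simp
    then show ?thesis using y single_code by (simp only: single_arrow one_closed)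
  qed
  assume "label y 0 = one"
  moreover have "restr model (PQ 0) (PQ 1) sigma y = x"
    using x by (simp add: diagrams_no_arrows model_def code_def fun_code_def)
  ultimately show "Ident model x y"
    unfolding Ident_def using y U EqPath_nontriv_iff[of 1 1]
    by (auto simp: Comp_iff single_arrow)
qed

lemma IdE_model: "IdE model"
  unfolding IdE_def carrier_model using Ident_iff single_code one_closed by blast

lemma EqPath_zero_Suc:
  assumes x: "x \<in> diagrams (PQ 0)" and y: "y \<in> diagrams (PQ (Suc l))"
  shows "EqPath model 0 (Suc l) x y \<longleftrightarrow> path_prod (label y) (Suc l) = one"
proof -
  have "EqPath model 0 (Suc l) x y \<longleftrightarrow>
      (\<exists>z\<in>diagrams (PQ 1). label z 0 = one \<and> label z 0 = path_prod (label y) (Suc l))"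
    unfolding EqPath.simps carrier_model
    by (rule bex_cong) (use assms in \<open>auto simp: Ident_iff EqPath_nontriv_iff single_arrow
        simp del: path_prod.simps One_nat_def\<close>)
  then show ?thesis using single_code one_closed by metis
qed

text \<open>The empty product is \<open>one\<close>, the label of every identity, so trivial paths
  fit the same formula. The \<open>EqPath\<close> axioms thereby become facts about equality and
  products in the monoid.\<close>

lemma EqPath_iff:
  assumes x: "x \<in> diagrams (PQ k)" and y: "y \<in> diagrams (PQ l)"
  shows "EqPath model k l x y \<longleftrightarrow> path_prod (label x) k = path_prod (label y) l"
proof (cases k)
  case 0
  with assms show ?thesis
    by (cases l) (auto simp: EqPath_zero_Suc diagrams_no_arrows simp del: EqPath.simps(2) path_prod.simps(2))
next
  case k: (Suc k')
  with assms show ?thesis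
    by (cases l) (auto simp: EqPath_zero_Suc EqPath_nontriv_iff simp del: EqPath.simps(2) path_prod.simps(2))
qed

lemma Tcat_model: "is_Tcat_model model"
  unfolding is_Tcat_model_def
proof (intro conjI PushoutEU_model IdE_model)
  have mor: "is_mor m Q Q'" "acyclic_quiver Q" "acyclic_quiver Q'" if "acyclic_embedding m Q Q'" for m Q Q'
    using that by (auto simp: acyclic_embedding_def is_embedding_def)
  show "is_model model"
    unfolding is_model_def using mor restr_in_diagrams by (auto simp: commute_iff)
  show "EmptyEU model" by (simp add: EmptyEU_def diagrams_no_arrows Q_empty_def)
  show "RestrComp model"
    unfolding RestrComp_def
  proof (intro allI impI ballI)
    fix Q Q' Q'' m m' x
    assume "acyclic_embedding m Q Q' \<and> acyclic_embedding m' Q' Q''" "x \<in> carrier model Q''"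
    then show "restr model Q Q' m (restr model Q' Q'' m' x) = restr model Q Q'' (mor_comp Q m' m) x"
      using mor[of m Q Q'] mor[of m' Q' Q''] is_morD(2)[of m Q Q']
      by (auto intro!: diagram_eqI[of Q] restr_in_diagrams is_mor_comp simp: acyclic_is_quiver)
  qed
  show "CompE model"
    unfolding CompE_def
  proof (intro ballI impI)
    fix x y assume "x \<in> carrier model (PQ 1)" "y \<in> carrier model (PQ 1)"
    then have xy: "x \<in> diagrams (PQ 1)" "y \<in> diagrams (PQ 1)" by simp_all
    then have "label x 0 \<odot> label y 0 \<in> U"
      using label_closed[of "PQ 1"] by (simp add: mult_closed)
    then show "\<exists>z\<in>carrier model (PQ 1). Comp model x y z"
      using single_code xy Comp_iff unfolding carrier_model by metis
  qed
  show "EqPathRefl model" "EqPathSym model" "EqPathTrans model"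
    by (auto simp: EqPathRefl_def EqPathSym_def EqPathTrans_def EqPath_iff)
  show "EqPathConcat model"
    unfolding EqPathConcat_def
  proof (intro allI impI ballI)
    \<comment> \<open>The cospan determines all labels of \<open>z\<close>: those of
      \<open>x\<close> followed by those of \<open>y\<close>.\<close>
    have *: "path_prod (label z) (k + l) = path_prod (label x) k \<odot> path_prod (label y) l"
      if "z \<in> diagrams (PQ (k + l))"
        "Cospan model (PQ k) (PQ l) (PQ (k + l)) (sp k (k + l)) (tp l (k + l)) x y z" for k l x y z
    proof -
      have "restr model (PQ k) (PQ (k + l)) (sp k (k + l)) z = x"
        "restr model (PQ l) (PQ (k + l)) (tp l (k + l)) z = y"
        using that by (simp_all add: Cospan_def)
      then have "i < k \<Longrightarrow> label x i = label z i" "i < l \<Longrightarrow> label y i = label z (k + i)" for i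
        by (auto simp: sp_def tp_def add.commute)
      then have "path_prod (label x) k = path_prod (label z) k"
        "path_prod (label y) l = path_prod (\<lambda>i. label z (k + i)) l"
        by (auto intro!: path_prod_cong)
      then show ?thesis using path_prod_add[of k l "label z"] label_closed[OF acyclic_PQ that(1)] by simp
    qed
    fix k1 k2 k1' k2' x1 x2 x1' x2' x1'' x2''
    assume x: "x1 \<in> carrier model (PQ k1)" "x2 \<in> carrier model (PQ k2)"
      "x1' \<in> carrier model (PQ k1')" "x2' \<in> carrier model (PQ k2')"
      "x1'' \<in> carrier model (PQ (k1 + k1'))" "x2'' \<in> carrier model (PQ (k2 + k2'))"
      and E: "EqPath model k1 k2 x1 x2 \<and> EqPath model k1' k2' x1' x2' \<and>
        restr model (PQ 0) (PQ k1) (tp 0 k1) x1 = restr model (PQ 0) (PQ k1') (sp 0 k1') x1'"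
      and C: "Cospan model (PQ k1) (PQ k1') (PQ (k1 + k1'))
          (sp k1 (k1 + k1')) (tp k1' (k1 + k1')) x1 x1' x1'' \<and>
        Cospan model (PQ k2) (PQ k2') (PQ (k2 + k2'))
          (sp k2 (k2 + k2')) (tp k2' (k2 + k2')) x2 x2' x2''"
    have "path_prod (label x1) k1 = path_prod (label x2) k2"
      "path_prod (label x1') k1' = path_prod (label x2') k2'"
      using E x by (simp_all add: EqPath_iff)
    then show "EqPath model (k1 + k1') (k2 + k2') x1'' x2''"
      using x C *[of x1'' k1 k1' x1 x1'] *[of x2'' k2 k2' x2 x2'] by (simp add: EqPath_iff)
  qed
  show "ComEq model"
    unfolding ComEq_def
  proof (intro ballI impI)
    fix x assume "x \<in> carrier model C2" and com: "x \<in> commute model C2"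
    then have x: "x \<in> diagrams C2" by simp
    have C2: "acyclic_quiver C2"
      by (rule acyclic_if_src_less_tgt) (auto simp: is_quiver_def C2_def)
    have m: "is_mor a0 (PQ 1) C2" "is_mor a1 (PQ 1) C2"
      by (auto simp: is_mor_PQ_iff a0_def a1_def arrow_mor_def C2_def)
    have "vmap a0 0 = vmap a1 0" "vmap a0 1 = vmap a1 1" by (auto simp: a0_def a1_def arrow_mor_def)
    then have "path_prod (label x \<circ> amap a0) 1 = path_prod (label x \<circ> amap a1) 1"
      using com m unfolding commute_iff by blast
    then have "path_prod (label (restr model (PQ 1) C2 a0 x)) 1 =
        path_prod (label (restr model (PQ 1) C2 a1 x)) 1"
      using m by (simp only: path_prod_restr)
    moreover note r = restr_in_diagrams[OF C2 m(1) x] restr_in_diagrams[OF C2 m(2) x]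
    ultimately have "label (restr model (PQ 1) C2 a0 x) 0 = label (restr model (PQ 1) C2 a1 x) 0"
      by (simp only: single_arrow)
    then show "restr model (PQ 1) C2 a0 x = restr model (PQ 1) C2 a1 x"
      using diagram_eqI[OF acyclic_PQ r] by simp
  qed
  show "PathCom model"
    unfolding PathCom_def
  proof (intro allI impI ballI)
    fix Q x assume Q: "acyclic_quiver Q" and "x \<in> carrier model Q"
    then have x: "x \<in> diagrams Q" by simp
    have "EqPath model k l (restr model (PQ k) Q p x) (restr model (PQ l) Q q x) \<longleftrightarrow>
        path_prod (label x \<circ> amap p) k = path_prod (label x \<circ> amap q) l"
      if "is_mor p (PQ k) Q" "is_mor q (PQ l) Q" for k p l q
      using that restr_in_diagrams[OF Q _ x] by (simp add: EqPath_iff path_prod_restr)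
    then show "(\<forall>((k, p), l, q)\<in>bipaths Q.
        EqPath model k l (restr model (PQ k) Q p x) (restr model (PQ l) Q q x)) \<longleftrightarrow>
        x \<in> commute model Q"
      using x unfolding commute_iff ball_bipaths_iff by blast
  qed
qed

end
section \<open>The monoid of congruence classes\<close>

text \<open>\<open>Unit\<close> is kept apart from the classes of trivial paths: there is one such
  class for each vertex, and none of them is neutral for all elements.\<close>

datatype path_class = Unit | Null | Class nat nat nat

instance path_class :: countable
  by countable_datatype

locale path_classes =
  fixes Q :: quiver and \<A> :: "nat set set"
  assumes acyclic: "acyclic_quiver Q"
begin

text \<open>The least congruent code is a canonical representative. A class is then given by three
  numbers, which makes the type countable without forming a quotient.\<close>

definition rep :: "nat \<Rightarrow> nat \<Rightarrow> nat \<Rightarrow> nat" where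
  "rep u v s = (LEAST t. pcong Q \<A> u v s t)"

lemma pcong_rep: "pcong Q \<A> u v s s \<Longrightarrow> pcong Q \<A> u v s (rep u v s)"
  unfolding rep_def by (rule LeastI)

lemma rep_eq:
  assumes "pcong Q \<A> u v s t"
  shows "rep u v s = rep u v t"
proof -
  have "pcong Q \<A> u v s r \<longleftrightarrow> pcong Q \<A> u v t r" for r
    using pcong.trans[OF assms] pcong.trans[OF pcong.sym[OF assms]] by blast
  then show ?thesis by (simp add: rep_def)
qed

lemma rep_eqD:
  assumes "pcong Q \<A> u v s s" "pcong Q \<A> u v t t" "rep u v s = rep u v t"
  shows "pcong Q \<A> u v s t"
  using pcong.trans[OF pcong_rep[OF assms(1)]] pcong.sym[OF pcong_rep[OF assms(2)]] assms(3)
  by simp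

lemma rep_add:
  assumes "pcong Q \<A> u v s s" "pcong Q \<A> v w t t"
  shows "rep u w (rep u v s + t) = rep u w (s + t)" "rep u w (s + rep v w t) = rep u w (s + t)"
    "rep u w (rep u v s + rep v w t) = rep u w (s + t)"
  using assms by (auto intro!: rep_eq[symmetric] pcong.concat pcong_rep)

definition classes :: "path_class set" where
  "classes = {Unit, Null} \<union> {Class u v (rep u v s) | u v s. pcong Q \<A> u v s s}"

fun mult :: "path_class \<Rightarrow> path_class \<Rightarrow> path_class" where
  "mult Unit y = y"
| "mult x Unit = x"
\<comment> \<open>A sum of least codes need not be least in its class, hence the outer
  \<open>rep\<close>.\<close>
| "mult (Class u v s) (Class v' w t) = (if v = v' then Class u w (rep u w (s + t)) else Null)"
| "mult _ _ = Null"

lemma classes_cases [consumes 1]: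
  assumes "x \<in> classes"
  obtains "x = Unit" | "x = Null" | u v s where "x = Class u v (rep u v s)" "pcong Q \<A> u v s s"
  using assms by (auto simp: classes_def)

lemma Class_in_classes: "pcong Q \<A> u v s s \<Longrightarrow> Class u v (rep u v s) \<in> classes"
  by (auto simp: classes_def)

lemma mult_Null [simp]: "mult x Null = Null" "mult Null x = Null"
  by (cases x; simp)+

lemma mult_Unit [simp]: "mult x Unit = x"
  by (cases x) simp_all

lemma mult_Class:
  assumes "pcong Q \<A> u v s s" "pcong Q \<A> v w t t"
  shows "mult (Class u v (rep u v s)) (Class v w (rep v w t)) = Class u w (rep u w (s + t))"
  using rep_add(3)[OF assms] by simp

lemma mult_in_classes:
  assumes "x \<in> classes" "y \<in> classes"
  shows "mult x y \<in> classes"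
  using assms(1)
proof (cases rule: classes_cases)
  case x: (3 u v s)
  from assms(2) show ?thesis
  proof (cases rule: classes_cases)
    case y: (3 v' w t)
    show ?thesis
    proof (cases "v = v'")
      case True
      then have "pcong Q \<A> u w (s + t) (s + t)" using x y by (auto intro: pcong.concat)
      then show ?thesis using mult_Class[of u v s w t] x y True by (simp add: Class_in_classes)
    qed (use x y in \<open>simp add: classes_def\<close>)
  qed (use assms in \<open>simp_all add: classes_def\<close>)
qed (use assms in \<open>simp_all add: classes_def\<close>)

lemma mult_assoc:
  assumes "x \<in> classes" "y \<in> classes" "z \<in> classes"
  shows "mult (mult x y) z = mult x (mult y z)"
  using assms(1)
proof (cases rule: classes_cases)
  case x: (3 u v s)
  from assms(2) show ?thesis
  proof (cases rule: classes_cases)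
    case y: (3 v' w t)
    from assms(3) show ?thesis
    proof (cases rule: classes_cases)
      case z: (3 w' r m)
      show ?thesis
      proof (cases "v = v' \<and> w = w'")
        case True
        note pc = x(2) y(2)[folded conjunct1[OF True]] z(2)[folded conjunct2[OF True]]
        have xy: "mult x y = Class u w (rep u w (s + t))"
          and yz: "mult y z = Class v r (rep v r (t + m))"
          using mult_Class[OF pc(1,2)] mult_Class[OF pc(2,3)] x y z True by simp_all
        show ?thesis
          using mult_Class[OF pcong.concat[OF pc(1,2)] pc(3)]
            mult_Class[OF pc(1) pcong.concat[OF pc(2,3)]] x z True
          unfolding xy yz by (simp add: add.assoc)
      qed (use x y z in auto)
    qed simp_all
  qed simp_all
qed simp_all

sublocale countable_monoid classes mult Unit
proof
  show "Unit \<in> classes" by (simp add: classes_def)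
qed (simp_all add: mult_in_classes mult_assoc)

definition arrow_class :: "nat \<Rightarrow> path_class" where
  "arrow_class a = Class (src Q a) (tgt Q a) (rep (src Q a) (tgt Q a) (2 ^ a))"

text \<open>Only nonempty initial segments are described, because the empty product is
  \<open>Unit\<close> and not the class of a trivial path.\<close>

lemma path_prod_arrow_class:
  assumes p: "is_mor p (PQ k) Q"
  shows "j < k \<Longrightarrow> path_prod (arrow_class \<circ> amap p) (Suc j) =
    Class (vmap p 0) (vmap p (Suc j)) (rep (vmap p 0) (vmap p (Suc j)) (prefix_code p (Suc j)))"
proof (induction j)
  case 0
  then show ?case
    using is_mor_PQD[OF p, of 0] by (simp add: arrow_class_def prefix_code_def)
next
  case (Suc j)
  let ?a = "amap p (Suc j)"
  have "arrow_class ?a = Class (vmap p (Suc j)) (vmap p (Suc (Suc j)))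
      (rep (vmap p (Suc j)) (vmap p (Suc (Suc j))) (2 ^ ?a))"
    using is_mor_PQD[OF p, of "Suc j"] Suc.prems by (simp add: arrow_class_def)
  then show ?case
    using Suc mult_Class[OF pcong_prefix[OF acyclic p less_imp_le[OF Suc.prems]]
          pcong_arrow[OF p Suc.prems]]
      prefix_code_Suc[OF acyclic p, of "Suc j"] by (simp del: mult.simps)
qed

lemma path_prod_class:
  assumes "is_path Q u v s k p" "k \<noteq> 0"
  shows "path_prod (arrow_class \<circ> amap p) k = Class u v (rep u v s)"
  using path_prod_arrow_class[of p k "k - 1"] assms by (simp add: is_path_def prefix_code_def)

lemma not_Commerge:
  assumes inst: "commerge_instance Q ms" and \<A>: "\<A> = images ms" and not: "\<not> all_congruent Q \<A>"
  shows "\<not> Commerge model Q ms"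
proof -
  let ?x = "code Q arrow_class"
  have x: "?x \<in> diagrams Q"
    by (rule code_in_diagrams) (simp add: arrow_class_def Class_in_classes pcong.arr)
  have prod: "path_prod (label ?x \<circ> amap p) k = path_prod (arrow_class \<circ> amap p) k"
    if "is_mor p (PQ k) Q" for p k
    by (rule path_prod_cong) (use is_mor_PQD(2)[OF that] acyclic in simp)
  have com: "restr model (fst (ms ! i)) Q (snd (ms ! i)) ?x \<in> commute model (fst (ms ! i))"
    if i: "i < length ms" for i
  proof -
    obtain Q' m where Q'm: "ms ! i = (Q', m)" by fastforce
    have Q': "acyclic_quiver Q'" and m: "is_mor m Q' Q"
      using inst i Q'm by (auto simp: commerge_instance_def is_embedding_def)
    have A: "amap m ` arrs Q' \<in> \<A>"
      using i Q'm nth_mem[OF i] by (force simp: \<A> images_def)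
    let ?y = "restr model Q' Q m ?x"
    have path: "is_mor (mor_comp (PQ k) m p) (PQ k) Q" "path_prod (label ?y \<circ> amap p) k =
        path_prod (arrow_class \<circ> amap (mor_comp (PQ k) m p)) k"
      if p: "is_mor p (PQ k) Q'" for p k
    proof -
      show r: "is_mor (mor_comp (PQ k) m p) (PQ k) Q"
        using is_mor_comp[OF _ p m] acyclic_is_quiver[OF acyclic_PQ] by blast
      show "path_prod (label ?y \<circ> amap p) k =
          path_prod (arrow_class \<circ> amap (mor_comp (PQ k) m p)) k"
        unfolding prod[OF r, symmetric] by (rule path_prod_cong) (use Q' is_mor_PQD(2)[OF p] in simp)
    qed
    have "?y \<in> commute model Q'"
      unfolding commute_iff
    proof (intro conjI allI impI restr_in_diagrams[OF acyclic m x])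
      fix k p l q
      assume p: "is_mor p (PQ k) Q'" and q: "is_mor q (PQ l) Q'"
        and v: "vmap p 0 = vmap q 0" "vmap p k = vmap q l"
      show "path_prod (label ?y \<circ> amap p) k = path_prod (label ?y \<circ> amap q) l"
      proof (cases "k = 0")
        case True
        then have "l = 0" using v path_trivial_iff[OF Q' q] by simp
        with True show ?thesis by simp
      next
        case False
        then have l: "l \<noteq> 0" using v path_trivial_iff[OF Q' p] by metis
        let ?r = "mor_comp (PQ k) m p" and ?r' = "mor_comp (PQ l) m q"
        let ?u = "vmap m (vmap p 0)" and ?v = "vmap m (vmap p k)"
        let ?s = "set_encode (amap ?r ` {0..<k})" and ?t = "set_encode (amap ?r' ` {0..<l})"
        have r: "is_path Q ?u ?v ?s k ?r" "is_path Q ?u ?v ?t l ?r'"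
          using path(1)[OF p] path(1)[OF q] v by (simp_all add: is_path_def)
        have sub: "set_decode ?s \<subseteq> amap m ` arrs Q'" "set_decode ?t \<subseteq> amap m ` arrs Q'"
          using is_mor_PQD(2)[OF p] is_mor_PQD(2)[OF q] by auto
        \<comment> \<open>Parallel paths of \<open>Q'\<close> are sent by \<open>m\<close> to paths
          inside its image, hence to a generating pair of the congruence.\<close>
        have "pcong Q \<A> ?u ?v ?s ?t"
          by (rule pcong.gen[OF A _ _ sub]) (use pcong_path_refl[OF acyclic] r in blast)+
        then show ?thesis
          unfolding path(2)[OF p] path(2)[OF q] path_prod_class[OF r(1) False] path_prod_class[OF r(2) l]
          by (simp add: rep_eq)
      qed
    qed
    with Q'm show ?thesis by simp
  qed
  have "?x \<notin> commute model Q"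
  proof
    assume "?x \<in> commute model Q"
    then have eq: "path_prod (arrow_class \<circ> amap p) k = path_prod (arrow_class \<circ> amap q) l"
      if "is_path Q u v s k p" "is_path Q u v t l q" for u v s t k p l q
      using that prod unfolding commute_iff is_path_def by metis
    obtain u v s t where st: "pcong Q \<A> u v s s" "pcong Q \<A> u v t t" "\<not> pcong Q \<A> u v s t"
      using not unfolding all_congruent_def by blast
    obtain k p l q where p: "is_path Q u v s k p" and q: "is_path Q u v t l q"
      using pcong_obtain_path[OF acyclic] st(1,2) by metis
    have iff: "k = 0 \<longleftrightarrow> u = v" "l = 0 \<longleftrightarrow> u = v"
      using path_trivial_iff[OF acyclic, of p k] path_trivial_iff[OF acyclic, of q l] p q
      by (auto simp: is_path_def)
    show False
    \<comment> \<open>If one path is trivial, then both are, and both have the code of the empty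
      set. So the separating pair is nontrivial, and its products are the two classes.\<close>
    proof (cases "k = 0")
      case True
      then have "s = t" using p q iff by (simp add: is_path_def)
      with st show False by simp
    next
      case False
      then have "Class u v (rep u v s) = Class u v (rep u v t)"
        using eq[OF p q] path_prod_class[OF p] path_prod_class[OF q] iff by simp
      then show False using rep_eqD st by blast
    qed
  qed
  with com x show ?thesis unfolding Commerge_def carrier_model by blast
qed

end

section \<open>Decidability\<close>

lemma pfst_le: "pfst z \<le> z" and psnd_le: "psnd z \<le> z"
  using le_prod_encode_1[of "pfst z" "psnd z"] le_prod_encode_2[of "psnd z" "pfst z"]
  by (simp_all add: pfst_def psnd_def)

text \<open>A nonempty list is coded by the successor of the pair of its head and the code of its
  tail, hence the subtraction of 1.\<close>

definition lhd :: "nat \<Rightarrow> nat" where "lhd l = pfst (l - 1)"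
definition ltl :: "nat \<Rightarrow> nat" where "ltl l = psnd (l - 1)"

lemma lhd_list_encode [simp]: "lhd (list_encode (x # xs)) = x"
  by (simp add: lhd_def)

lemma ltl_list_encode [simp]: "ltl (list_encode xs) = list_encode (tl xs)"
proof (cases xs)
  case Nil
  \<comment> \<open>The empty list has code 0 and must be its own tail, so that iterating
    \<open>ltl\<close> agrees with \<open>drop\<close> past the end of a list.\<close>
  have "psnd 0 = 0" using psnd_le[of 0] by simp
  with Nil show ?thesis by (simp add: ltl_def)
qed (simp add: ltl_def)

lemma ltl_funpow_list_encode: "(ltl ^^ i) (list_encode xs) = list_encode (drop i xs)"
  by (induction i) (simp_all del: list_encode.simps add: tl_drop drop_Suc)

lemma lhd_le: "lhd l \<le> l" and ltl_le: "ltl l \<le> l"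
  using pfst_le[of "l - 1"] psnd_le[of "l - 1"] by (simp_all add: lhd_def ltl_def)

lemma length_le_list_encode: "length xs \<le> list_encode xs"
proof (induction xs)
  case (Cons x xs)
  then show ?case using le_prod_encode_2[of "list_encode xs" x] by simp
qed simp

lemma recursive_lhd [rec_intros]: "recursive f \<Longrightarrow> recursive (\<lambda>x. lhd (f x))"
  and recursive_ltl [rec_intros]: "recursive f \<Longrightarrow> recursive (\<lambda>x. ltl (f x))"
  unfolding lhd_def ltl_def by (intro rec_intros; assumption)+

lemma mem_set_decode_less: "n \<in> set_decode s \<Longrightarrow> n < s"
proof -
  assume "n \<in> set_decode s"
  then have "odd (s div 2 ^ n)" by (simp add: set_decode_def)
  then have "s div 2 ^ n \<noteq> 0" by (metis even_zero)
  then have "2 ^ n \<le> s" by (simp add: div_eq_0_iff)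
  then show "n < s" using less_exp[of n] by linarith
qed

lemma set_encode_mono: "finite B \<Longrightarrow> A \<subseteq> B \<Longrightarrow> set_encode A \<le> set_encode B"
  by (simp add: set_encode_def sum_mono2)

lemma set_encode_less: "A \<subseteq> {..n} \<Longrightarrow> set_encode A < 2 ^ Suc n"
proof -
  assume "A \<subseteq> {..n}"
  then have "set_encode A \<le> set_encode {..n}" by (rule set_encode_mono[OF finite_atMost])
  also have "\<dots> = 2 ^ Suc n - 1"
    using sum_power2[of "Suc n"] by (simp add: set_encode_def atLeast0LessThan lessThan_Suc_atMost)
  finally show ?thesis by (metis Suc_diff_1 le_imp_less_Suc zero_less_numeral zero_less_power)
qed

lemma prod_encode_mono: "a \<le> c \<Longrightarrow> b \<le> d \<Longrightarrow> prod_encode (a, b) \<le> prod_encode (c, d)"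
  by (simp add: prod_encode_def add_mono triangle_mono)

lemma mem_fun_code:
  "finite A \<Longrightarrow> prod_encode (a, y) \<in> set_decode (fun_code A f) \<longleftrightarrow> a \<in> A \<and> y = f a"
  by (auto simp: fun_code_def)

section \<open>Reading an instance and its congruence off the code\<close>

definition verts_code :: "nat \<Rightarrow> nat" where "verts_code c = lhd (pfst c)"
definition arrs_code :: "nat \<Rightarrow> nat" where "arrs_code c = lhd (ltl (pfst c))"
definition src_code :: "nat \<Rightarrow> nat" where "src_code c = lhd (ltl (ltl (pfst c)))"
definition tgt_code :: "nat \<Rightarrow> nat" where "tgt_code c = lhd (ltl (ltl (ltl (pfst c))))"
text \<open>The code of the list of embeddings from position \<open>i\<close> on. It is positive
  exactly for valid positions, as only the empty list has code 0.\<close>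

definition ms_code :: "nat \<Rightarrow> nat \<Rightarrow> nat" where "ms_code c i = (ltl ^^ i) (psnd c)"
definition amap_code :: "nat \<Rightarrow> nat \<Rightarrow> nat" where
  "amap_code c i = psnd (psnd (lhd (ms_code c i)))"

text \<open>An element of a coded set is below the code of the set, and a component of a pair is at
  most the code of the pair; hence the two bounds.\<close>

definition in_image :: "nat \<Rightarrow> nat \<Rightarrow> nat \<Rightarrow> bool" where
  "in_image c i s \<longleftrightarrow> (\<forall>b<s. b \<in> set_decode s \<longrightarrow>
     (\<exists>a<Suc (amap_code c i). prod_encode (a, b) \<in> set_decode (amap_code c i)))"

definition rel :: "nat \<Rightarrow> nat \<Rightarrow> nat \<Rightarrow> nat \<Rightarrow> nat \<Rightarrow> bool" where
  "rel K u v s t \<longleftrightarrow> prod_encode (prod_encode (u, v), prod_encode (s, t)) \<in> set_decode K"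

text \<open>The rules of the congruence. The code of an instance bounds all vertices, arrows and path codes
  in it, so that all quantifiers can be bounded.\<close>

definition closed_code :: "nat \<Rightarrow> nat \<Rightarrow> bool" where
  "closed_code c K \<longleftrightarrow>
     (\<forall>u<Suc c. u \<in> set_decode (verts_code c) \<longrightarrow> rel K u u 0 0) \<and>
     (\<forall>a<Suc c. \<forall>u<Suc c. \<forall>v<Suc c. a \<in> set_decode (arrs_code c) \<longrightarrow>
        prod_encode (a, u) \<in> set_decode (src_code c) \<longrightarrow>
        prod_encode (a, v) \<in> set_decode (tgt_code c) \<longrightarrow> rel K u v (2 ^ a) (2 ^ a)) \<and>
     (\<forall>u<Suc c. \<forall>v<Suc c. \<forall>s<Suc c. \<forall>t<Suc c. rel K u v s t \<longrightarrow> rel K u v t s) \<and>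
     (\<forall>u<Suc c. \<forall>v<Suc c. \<forall>s<Suc c. \<forall>t<Suc c. \<forall>r<Suc c.
        rel K u v s t \<longrightarrow> rel K u v t r \<longrightarrow> rel K u v s r) \<and>
     (\<forall>u<Suc c. \<forall>v<Suc c. \<forall>w<Suc c. \<forall>s<Suc c. \<forall>t<Suc c. \<forall>s'<Suc c. \<forall>t'<Suc c.
        rel K u v s t \<longrightarrow> rel K v w s' t' \<longrightarrow> rel K u w (s + s') (t + t')) \<and>
     (\<forall>i<Suc c. \<forall>u<Suc c. \<forall>v<Suc c. \<forall>s<Suc c. \<forall>t<Suc c. 0 < ms_code c i \<longrightarrow>
        rel K u v s s \<longrightarrow> rel K u v t t \<longrightarrow> in_image c i s \<longrightarrow> in_image c i t \<longrightarrow> rel K u v s t)"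

text \<open>The exponent is the successor of the largest code of a quadruple with entries up to
  \<open>c\<close>, so \<open>K\<close> runs over all sets of such quadruples, the congruence among
  them.\<close>

definition cong_code :: "nat \<Rightarrow> nat \<Rightarrow> nat \<Rightarrow> nat \<Rightarrow> nat \<Rightarrow> bool" where
  "cong_code c u v s t \<longleftrightarrow>
     (\<forall>K<2 ^ Suc (prod_encode (prod_encode (c, c), prod_encode (c, c))).
        closed_code c K \<longrightarrow> rel K u v s t)"

definition all_cong_code :: "nat \<Rightarrow> bool" where
  "all_cong_code c \<longleftrightarrow> (\<forall>u<Suc c. \<forall>v<Suc c. \<forall>s<Suc c. \<forall>t<Suc c.
     cong_code c u v s s \<longrightarrow> cong_code c u v t t \<longrightarrow> cong_code c u v s t)"

lemma recursive_selectors [rec_intros]: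
  "recursive f \<Longrightarrow> recursive (\<lambda>x. verts_code (f x))"
  "recursive f \<Longrightarrow> recursive (\<lambda>x. arrs_code (f x))"
  "recursive f \<Longrightarrow> recursive (\<lambda>x. src_code (f x))"
  "recursive f \<Longrightarrow> recursive (\<lambda>x. tgt_code (f x))"
  "recursive f \<Longrightarrow> recursive g \<Longrightarrow> recursive (\<lambda>x. ms_code (f x) (g x))"
  "recursive f \<Longrightarrow> recursive g \<Longrightarrow> recursive (\<lambda>x. amap_code (f x) (g x))"
  unfolding verts_code_def arrs_code_def src_code_def tgt_code_def ms_code_def amap_code_def
  by (intro rec_intros; assumption)+

lemma decidable_comp: "decidable P \<Longrightarrow> recursive f \<Longrightarrow> decidable (\<lambda>x. P (f x))"
  unfolding decidable_def by (rule recursive_comp)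

lemma decidable_rel [rec_intros]:
  "recursive k \<Longrightarrow> recursive u \<Longrightarrow> recursive v \<Longrightarrow> recursive s \<Longrightarrow> recursive t \<Longrightarrow>
   decidable (\<lambda>x. rel (k x) (u x) (v x) (s x) (t x))"
  unfolding rel_def by (intro rec_intros)

text \<open>Decidability is proved for the components of a code, which the rules handle under
  quantifiers, and the actual arguments are substituted afterwards.\<close>

lemma decidable_in_image [rec_intros]:
  assumes "recursive f" "recursive g" "recursive h"
  shows "decidable (\<lambda>x. in_image (f x) (g x) (h x))"
proof -
  have "decidable (\<lambda>z. in_image (pfst z) (pfst (psnd z)) (psnd (psnd z)))"
    unfolding in_image_def by (intro rec_intros)
  from decidable_comp[OF this, of "\<lambda>x. prod_encode (f x, prod_encode (g x, h x))"] assms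
  show ?thesis by (simp add: rec_intros)
qed

lemma decidable_closed_code [rec_intros]:
  assumes "recursive f" "recursive g"
  shows "decidable (\<lambda>x. closed_code (f x) (g x))"
proof -
  have "decidable (\<lambda>z. closed_code (pfst z) (psnd z))"
    unfolding closed_code_def by (intro rec_intros)
  from decidable_comp[OF this, of "\<lambda>x. prod_encode (f x, g x)"] assms
  show ?thesis by (simp add: rec_intros)
qed

lemma decidable_all_cong_code: "decidable all_cong_code"
  unfolding all_cong_code_def cong_code_def by (intro rec_intros)

locale coded_instance =
  fixes Q :: quiver and ms :: "(quiver \<times> qmor) list" and c :: nat
  assumes inst: "commerge_instance Q ms"
  defines "c \<equiv> instance_code Q ms"
begin

lemma acyclic: "acyclic_quiver Q"
  using inst by (simp add: commerge_instance_def)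

lemma finite_Q: "finite (verts Q)" "finite (arrs Q)"
  using acyclic_is_quiver[OF acyclic] by (simp_all add: is_quiver_def)

lemma quiver_selectors:
  "verts_code c = set_encode (verts Q)" "arrs_code c = set_encode (arrs Q)"
  "src_code c = fun_code (arrs Q) (src Q)" "tgt_code c = fun_code (arrs Q) (tgt Q)"
  unfolding c_def instance_code_def quiver_code_def verts_code_def arrs_code_def src_code_def
    tgt_code_def
  by (simp_all del: list_encode.simps)

lemma ms_code: "0 < ms_code c i \<longleftrightarrow> i < length ms"
  unfolding c_def instance_code_def ms_code_def psnd_pair ltl_funpow_list_encode
  by (cases "i < length ms") (simp_all add: Cons_nth_drop_Suc[symmetric] del: Cons_nth_drop_Suc)

lemma amap_code:
  assumes "i < length ms"
  shows "amap_code c i = fun_code (arrs (fst (ms ! i))) (amap (snd (ms ! i)))"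
  using assms
  unfolding c_def instance_code_def ms_code_def amap_code_def psnd_pair ltl_funpow_list_encode
  by (simp add: Cons_nth_drop_Suc[symmetric] mor_code_def case_prod_beta
      del: list_encode.simps)

lemma in_image:
  assumes i: "i < length ms"
  shows "in_image c i s \<longleftrightarrow> set_decode s \<subseteq> amap (snd (ms ! i)) ` arrs (fst (ms ! i))"
proof -
  have "acyclic_quiver (fst (ms ! i))" using inst i by (simp add: commerge_instance_def)
  then have fin: "finite (arrs (fst (ms ! i)))" using acyclic_is_quiver by (simp add: is_quiver_def)
  have "a < Suc (amap_code c i)" if "prod_encode (a, b) \<in> set_decode (amap_code c i)" for a b
    using mem_set_decode_less[OF that] le_prod_encode_1[of a b] by simp
  then have "in_image c i s \<longleftrightarrow>
      (\<forall>b\<in>set_decode s. \<exists>a. prod_encode (a, b) \<in> set_decode (amap_code c i))"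
    unfolding in_image_def using mem_set_decode_less by blast
  then show ?thesis by (auto simp: amap_code[OF i] mem_fun_code[OF fin])
qed

lemma vert_le: "u \<in> verts Q \<Longrightarrow> u \<le> c"
proof -
  assume "u \<in> verts Q"
  then have "u < verts_code c"
    by (intro mem_set_decode_less) (simp add: quiver_selectors finite_Q)
  also have "\<dots> \<le> c" unfolding verts_code_def by (meson lhd_le pfst_le le_trans)
  finally show "u \<le> c" by simp
qed

lemma arrs_code_le: "set_encode (arrs Q) \<le> c"
  unfolding quiver_selectors(2)[symmetric] arrs_code_def by (meson lhd_le ltl_le pfst_le le_trans)

lemma length_ms_le: "length ms \<le> c"
proof -
  have "length ms \<le> psnd c"
    unfolding c_def instance_code_def psnd_pair by (metis length_le_list_encode length_map)
  then show ?thesis using psnd_le le_trans by blast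
qed

text \<open>The arrows of a path form a subset of all arrows, and \<open>set_encode\<close> is
  monotone on finite sets.\<close>

lemma pcong_le:
  assumes "pcong Q \<A> u v s t"
  shows "u < Suc c" "v < Suc c" "s < Suc c" "t < Suc c"
proof -
  obtain k p l q where pq: "is_path Q u v s k p" "is_path Q u v t l q"
    using pcong_obtain_path[OF acyclic assms] .
  have le: "u \<le> c \<and> v \<le> c \<and> s \<le> c" if "is_path Q u v s k p" for k p s
  proof -
    have p: "is_mor p (PQ k) Q" and s: "s = set_encode (amap p ` {0..<k})"
      and uv: "u = vmap p 0" "v = vmap p k"
      using that by (simp_all add: is_path_def)
    have "s \<le> set_encode (arrs Q)"
      unfolding s by (rule set_encode_mono[OF finite_Q(2)]) (use is_mor_PQD(2)[OF p] in auto)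
    then show ?thesis using arrs_code_le is_mor_PQD(1)[OF p] uv vert_le by auto
  qed
  then show "u < Suc c" "v < Suc c" "s < Suc c" "t < Suc c" using pq by (simp_all add: le_imp_less_Suc)
qed

definition pcong_set :: "nat set" where
  "pcong_set = {prod_encode (prod_encode (u, v), prod_encode (s, t)) | u v s t.
     pcong Q (images ms) u v s t}"

lemma pcong_set_bound:
  "pcong_set \<subseteq> {..prod_encode (prod_encode (c, c), prod_encode (c, c))}"
  using pcong_le by (fastforce simp: pcong_set_def less_Suc_eq_le intro!: prod_encode_mono)

lemma rel_pcong_set: "rel (set_encode pcong_set) u v s t \<longleftrightarrow> pcong Q (images ms) u v s t"
proof -
  have "finite pcong_set" using pcong_set_bound finite_subset by blast
  then show ?thesis by (simp add: rel_def pcong_set_def prod_encode_eq)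
qed

lemma images_nth: "i < length ms \<Longrightarrow> amap (snd (ms ! i)) ` arrs (fst (ms ! i)) \<in> images ms"
  unfolding images_def by (rule image_eqI[OF _ nth_mem]) (simp_all add: case_prod_beta)

text \<open>The congruence is itself one of the closed relations, so what lies in all of them lies
  in the congruence.\<close>

lemma closed_pcong_set: "closed_code c (set_encode pcong_set)"
  unfolding closed_code_def rel_pcong_set quiver_selectors ms_code
proof (intro conjI allI impI)
  fix a u v
  assume "a \<in> set_decode (set_encode (arrs Q))"
    "prod_encode (a, u) \<in> set_decode (fun_code (arrs Q) (src Q))"
    "prod_encode (a, v) \<in> set_decode (fun_code (arrs Q) (tgt Q))"
  then show "pcong Q (images ms) u v (2 ^ a) (2 ^ a)"
    using finite_Q by (simp add: mem_fun_code pcong.arr)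
next
  fix i u v s t
  assume "i < length ms" "pcong Q (images ms) u v s s" "pcong Q (images ms) u v t t"
    "in_image c i s" "in_image c i t"
  then show "pcong Q (images ms) u v s t"
    using pcong.gen[OF images_nth] by (simp add: in_image)
qed (use finite_Q in \<open>auto intro: pcong.vert pcong.sym pcong.trans pcong.concat\<close>)

text \<open>The rules in \<open>closed_code\<close> apply only to arguments up to \<open>c\<close>;
  by \<open>pcong_le\<close> every rule used in a derivation stays within this range.\<close>

lemma rel_if_pcong:
  assumes "closed_code c K" "pcong Q (images ms) u v s t"
  shows "rel K u v s t"
  using assms(2)
proof (induction rule: pcong.induct)
  case (vert u)
  then show ?case
    using assms(1) vert_le[OF vert] finite_Q unfolding closed_code_def quiver_selectors by auto
next
  case (arr a)
  have "a < Suc c"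
    using mem_set_decode_less[of a "set_encode (arrs Q)"] arr finite_Q arrs_code_le by simp
  moreover have "src Q a < Suc c" "tgt Q a < Suc c"
    using pcong_le[OF pcong.arr[OF arr]] by blast+
  ultimately show ?case
    using assms(1) arr finite_Q unfolding closed_code_def quiver_selectors by (simp add: mem_fun_code)
next
  case (sym u v s t)
  show ?case
    using pcong_le[OF sym.hyps] sym.IH
    by (rule assms(1)[unfolded closed_code_def, THEN conjunct2, THEN conjunct2, THEN conjunct1,
          rule_format])
next
  case (trans u v s t r)
  show ?case
    using pcong_le[OF trans.hyps(1)] pcong_le(4)[OF trans.hyps(2)] trans.IH
    by (rule assms(1)[unfolded closed_code_def, THEN conjunct2, THEN conjunct2, THEN conjunct2,
          THEN conjunct1, rule_format])
next
  case (concat u v s t w s' t')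
  show ?case
    using pcong_le(1,2)[OF concat.hyps(1)] pcong_le(2)[OF concat.hyps(2)]
      pcong_le(3,4)[OF concat.hyps(1)] pcong_le(3,4)[OF concat.hyps(2)] concat.IH
    by (rule assms(1)[unfolded closed_code_def, THEN conjunct2, THEN conjunct2, THEN conjunct2,
          THEN conjunct2, THEN conjunct1, rule_format])
next
  case (gen A u v s t)
  obtain i where i: "i < length ms" "A = amap (snd (ms ! i)) ` arrs (fst (ms ! i))"
    using gen.hyps(1) by (auto simp: images_def in_set_conv_nth)
  then have bound: "i < Suc c" "0 < ms_code c i" and image: "in_image c i s" "in_image c i t"
    using gen.hyps length_ms_le by (simp_all add: ms_code in_image)
  show ?case
    using bound(1) pcong_le(1-3)[OF gen.hyps(2)] pcong_le(3)[OF gen.hyps(3)] bound(2) gen.IH image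
    by (rule assms(1)[unfolded closed_code_def, THEN conjunct2, THEN conjunct2, THEN conjunct2,
          THEN conjunct2, THEN conjunct2, rule_format])
qed

lemma cong_code_iff: "cong_code c u v s t \<longleftrightarrow> pcong Q (images ms) u v s t"
proof
  assume "cong_code c u v s t"
  then show "pcong Q (images ms) u v s t"
    using closed_pcong_set set_encode_less[OF pcong_set_bound]
    unfolding cong_code_def rel_pcong_set[symmetric] by blast
qed (use rel_if_pcong in \<open>auto simp: cong_code_def\<close>)

lemma all_cong_code_iff: "all_cong_code c \<longleftrightarrow> all_congruent Q (images ms)"
proof
  assume all: "all_cong_code c"
  show "all_congruent Q (images ms)"
    unfolding all_congruent_def
  proof (intro allI impI)
    fix u v s t assume s: "pcong Q (images ms) u v s s" and t: "pcong Q (images ms) u v t t"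
    show "pcong Q (images ms) u v s t"
      using pcong_le(1-3)[OF s] pcong_le(3)[OF t] s t
      by (rule all[unfolded all_cong_code_def cong_code_iff, rule_format])
  qed
next
  assume all: "all_congruent Q (images ms)"
  show "all_cong_code c"
    unfolding all_cong_code_def cong_code_iff
    by (intro allI impI) (rule all[unfolded all_congruent_def, rule_format])
qed

end

theorem theorem28:
  "\<exists>e. \<forall>Q ms. commerge_instance Q ms \<longrightarrow>
     rec_eval e [instance_code Q ms] 1 \<and>
       (\<forall>M :: 'a interp. is_Tcat_model M \<longrightarrow> Commerge M Q ms) \<and>
       (\<forall>M :: nat interp. is_Tcat_model M \<longrightarrow> Commerge M Q ms)
     \<or> rec_eval e [instance_code Q ms] 0 \<and>
       (\<exists>M :: nat interp. is_Tcat_model M \<and> \<not> Commerge M Q ms)"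
proof -
  \<comment> \<open>The program is fixed before the instance is given and does not depend on the
    carrier type.\<close>
  obtain e where e: "rec_eval e [x] (of_bool (all_cong_code x))" for x
    using decidable_all_cong_code unfolding decidable_def recursive_def by blast
  show ?thesis
  proof (intro exI[of _ e] allI impI)
    fix Q ms assume inst: "commerge_instance Q ms"
    then interpret coded_instance Q ms "instance_code Q ms"
      by unfold_locales
    show "rec_eval e [instance_code Q ms] 1 \<and>
        (\<forall>M :: 'a interp. is_Tcat_model M \<longrightarrow> Commerge M Q ms) \<and>
        (\<forall>M :: nat interp. is_Tcat_model M \<longrightarrow> Commerge M Q ms)
      \<or> rec_eval e [instance_code Q ms] 0 \<and>
        (\<exists>M :: nat interp. is_Tcat_model M \<and> \<not> Commerge M Q ms)"
    proof (cases "all_congruent Q (images ms)")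
      case True
      then have "rec_eval e [instance_code Q ms] 1"
        using e[of "instance_code Q ms"] by (simp add: all_cong_code_iff)
      moreover have "Commerge M Q ms" if "is_Tcat_model M" for M :: "'a interp"
        using Tcat_model.Commerge_if_all_congruent[OF Tcat_model.intro[OF that] inst True] .
      moreover have "Commerge M Q ms" if "is_Tcat_model M" for M :: "nat interp"
        using Tcat_model.Commerge_if_all_congruent[OF Tcat_model.intro[OF that] inst True] .
      ultimately show ?thesis by blast
    next
      case False
      \<comment> \<open>The path classes are countable, so the refuting model is over
        \<open>nat\<close>, as a negative answer requires.\<close>
      interpret path_classes Q "images ms" by unfold_locales (rule acyclic)
      have "rec_eval e [instance_code Q ms] 0"
        using e[of "instance_code Q ms"] False by (simp add: all_cong_code_iff)
      then show ?thesis using Tcat_model not_Commerge[OF inst refl False] by blast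
    qed
  qed
qed

end
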